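(* Let $r$ and $b$ be nonnegative integers. (a) $\mathcal{U}(r,b)=0$ if and only if $r=3b$ or $b=3r$. (b) $\mathcal{U}(2k+1,2k)\geq 5$ for every integer $k\geq 4$.
   Context: All point sets are in general position (no three collinear). An $(r,b)$-set is a set $S=R\cup B$ of $r$ red points and $b$ blue points in general position. A subset $X\subseteq S$ can be $K_{1,3}$-covered if $X$ can be partitioned into subsets of size $4$, each consisting of one point (the center) of one color and three points of the other color, such that the straight-line segments joining each center to the three other points of its subset are pairwise non-crossing (no two intersect except at a common endpoint). $\mathcal{C}(S)$ is the maximum size of a subset of $S$ that can be $K_{1,3}$-covered, $\mathcal{U}(S)=|S|-\mathcal{C}(S)$, and $\mathcal{U}(r,b)$ is the maximum of $\mathcal{U}(S)$ over all $(r,b)$-sets $S$. *)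

theory Defs
  imports "HOL-Analysis.Analysis" "HOL-Library.Disjoint_Sets"
begin

type_synonym point = "real ^ 2"

definition general_position :: "point set \<Rightarrow> bool" where
  "general_position S \<longleftrightarrow> (\<forall>T\<subseteq>S. card T = 3 \<longrightarrow> \<not> collinear T)"

text \<open>A bicoloured point set is given by its red part \<open>R\<close> and its blue part \<open>B\<close>.\<close>

definition rb_set :: "nat \<Rightarrow> nat \<Rightarrow> point set \<Rightarrow> point set \<Rightarrow> bool" where
  "rb_set r b R B \<longleftrightarrow> finite R \<and> finite B \<and> R \<inter> B = {} \<and> card R = r \<and> card B = b \<and>
     general_position (R \<union> B)"

text \<open>A pair \<open>(p, q)\<close> stands for the straight-line segment from \<open>p\<close> to \<open>q\<close>.\<close>

definition noncrossing :: "(point \<times> point) set \<Rightarrow> bool" where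
  "noncrossing E \<longleftrightarrow> (\<forall>(p, q)\<in>E. \<forall>(p', q')\<in>E. (p, q) \<noteq> (p', q') \<longrightarrow>
     closed_segment p q \<inter> closed_segment p' q' \<subseteq> {p, q} \<inter> {p', q'})"

text \<open>\<open>P\<close> is the partition of \<open>X\<close> and \<open>c Y\<close> is the center of the part \<open>Y\<close>. The non-crossing
  condition concerns all segments of all parts together.\<close>

definition K13_coverable :: "point set \<Rightarrow> point set \<Rightarrow> point set \<Rightarrow> bool" where
  "K13_coverable R B X \<longleftrightarrow> (\<exists>P c. partition_on X P \<and>
     (\<forall>Y\<in>P. card Y = 4 \<and> c Y \<in> Y \<and>
        (c Y \<in> R \<and> Y - {c Y} \<subseteq> B \<or> c Y \<in> B \<and> Y - {c Y} \<subseteq> R)) \<and>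
     noncrossing {(c Y, q) | Y q. Y \<in> P \<and> q \<in> Y - {c Y}})"

definition covered :: "point set \<Rightarrow> point set \<Rightarrow> nat" where
  "covered R B = Max {card X | X. X \<subseteq> R \<union> B \<and> K13_coverable R B X}"

definition uncovered :: "point set \<Rightarrow> point set \<Rightarrow> nat" where
  "uncovered R B = card (R \<union> B) - covered R B"

definition max_uncovered :: "nat \<Rightarrow> nat \<Rightarrow> nat" where
  "max_uncovered r b = Max {uncovered R B | R B. rb_set r b R B}"

end

theory Submission
  imports Defs "HOL-Combinatorics.Transposition"
begin

text \<open>
  If \<open>r = 3 b\<close>, give every blue point three red points so that the total length of the segments
  is minimal; a crossing could be removed by swapping two red points, which shortens the total length.

  Conversely, let \<open>b \<le> r\<close> and place the points in convex position, numbered along the hull. An edge of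
  a star has every other star of the cover on one side, so the number of points it cuts off
  is congruent modulo 4 to the number of points of its own star that it cuts off. Hence the parities
  alternate along each star, and each star has two even points. If all even points are red, then
  every star has three red points and one blue point, so \<open>r = 3 b\<close>.

  For part (b), take \<open>n = 4 k\<close> points in convex position with alternating colours, and a red apex
  close to the centre of the polygon. Suppose only one point \<open>p\<close> is left out. It is not the apex,
  by the parity argument. If the apex is a centre, then each sector between two of its leaves has an
  odd number of vertices, so at least two of the three sectors would have to contain \<open>p\<close>. If the
  apex is a leaf of a star whose centre is, after a rotation, the vertex \<open>0\<close>, then by parity every
  other star has points on both sides of \<open>p\<close>. This forces the other two leaves to be \<open>1\<close> and
  \<open>n - 1\<close>, and \<open>2\<close> and \<open>n - 2\<close> to lie in one star, whose centre is \<open>3\<close> or \<open>n - 3\<close>. Its longest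
  edge then separates \<open>0\<close> from the apex.
\<close>

section \<open>Segments, general position and the extremal quantities\<close>

text \<open>Twice the signed area of the triangle \<open>p q r\<close>, positive when it is
  traversed counterclockwise.\<close>

definition orient :: "point \<Rightarrow> point \<Rightarrow> point \<Rightarrow> real" where
  "orient p q r = (q$1 - p$1) * (r$2 - p$2) - (q$2 - p$2) * (r$1 - p$1)"

lemma collinear_imp_orient_0:
  assumes "collinear T" "a \<in> T" "b \<in> T" "c \<in> T"
  shows "orient a b c = 0"
proof -
  from assms(1) obtain u where u: "\<forall>x\<in>T. \<forall>y\<in>T. \<exists>s. x - y = s *\<^sub>R u"
    by (auto simp: collinear_def)
  obtain s t where "b - a = s *\<^sub>R u" "c - a = t *\<^sub>R u"
    using u assms by meson
  then have "b$i - a$i = s * u$i" "c$i - a$i = t * u$i" for i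
    by (metis vector_minus_component vector_scaleR_component real_scaleR_def)+
  then show ?thesis by (simp add: orient_def)
qed

lemma segments_meet:
  assumes "orient a b c * orient a b d < 0" "orient c d a * orient c d b < 0"
  shows "closed_segment a b \<inter> closed_segment c d \<noteq> {}"
proof -
  \<comment> \<open>\<open>orient\<close> is affine in its last argument, so its zero along
    \<open>c d\<close> is at parameter \<open>t\<close>, and similarly along \<open>a b\<close> at
    \<open>s\<close>; these are the two parameters of the crossing point.\<close>
  define t where "t = orient a b c / (orient a b c - orient a b d)"
  define s where "s = orient c d a / (orient c d a - orient c d b)"
  have t: "0 \<le> t" "t \<le> 1" and s: "0 \<le> s" "s \<le> 1"
    using assms by (auto simp: t_def s_def divide_simps mult_less_0_iff)
  have nz: "orient a b c - orient a b d \<noteq> 0" "orient c d a - orient c d b \<noteq> 0"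
    using assms by (auto simp: mult_less_0_iff)
  \<comment> \<open>Both denominators are the cross product of the two directions, up to
    sign.\<close>
  have e: "orient c d a - orient c d b = - (orient a b c - orient a b d)"
    by (simp add: orient_def algebra_simps)
  have s': "s = - orient c d a / (orient a b c - orient a b d)"
    by (simp only: s_def e divide_minus_left divide_minus_right)
  have id: "(orient a b c - orient a b d) * a$i - orient c d a * (b$i - a$i) =
     (orient a b c - orient a b d) * c$i + orient a b c * (d$i - c$i)" if "i = 1 \<or> i = 2" for i
    using that by (auto simp: orient_def algebra_simps)
  have "((1 - s) *\<^sub>R a + s *\<^sub>R b) $ i = ((1 - t) *\<^sub>R c + t *\<^sub>R d) $ i" for i
  proof -
    have "i = 1 \<or> i = 2" using exhaust_2 by blast
    from id[OF this] have "a$i + s * (b$i - a$i) = c$i + t * (d$i - c$i)"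
      unfolding s' t_def using nz(1) by (simp add: field_simps)
    then show ?thesis by (simp add: algebra_simps)
  qed
  then have "(1 - s) *\<^sub>R a + s *\<^sub>R b = (1 - t) *\<^sub>R c + t *\<^sub>R d"
    by (simp add: vec_eq_iff)
  then show ?thesis using s t by (auto simp: closed_segment_def)
qed

lemma general_position_image:
  fixes pt :: "nat \<Rightarrow> point"
  assumes "\<And>a b c. a < b \<Longrightarrow> b < c \<Longrightarrow> c < N \<Longrightarrow> orient (pt a) (pt b) (pt c) \<noteq> 0"
  shows "general_position (pt ` {..<N})"
  unfolding general_position_def
proof (intro allI impI notI)
  fix T assume T: "T \<subseteq> pt ` {..<N}" "card T = 3" "collinear T"
  from T(1) obtain J where J: "J \<subseteq> {..<N}" "inj_on pt J" "T = pt ` J"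
    by (metis subset_image_inj)
  then have "card J = 3" using T(2) by (simp add: card_image)
  then obtain x y z where xyz: "J = {x, y, z}" "x \<noteq> y" "x \<noteq> z" "y \<noteq> z"
    by (auto simp: card_3_iff)
  have "\<exists>a b c. a \<in> J \<and> b \<in> J \<and> c \<in> J \<and> a < b \<and> b < c"
    using xyz by (metis insertCI linorder_neqE_nat)
  then obtain a b c where "a \<in> J" "b \<in> J" "c \<in> J" "a < b" "b < c" by blast
  then show False using assms[of a b c] J T(3)
    by (metis collinear_imp_orient_0 image_eqI lessThan_iff subsetD)
qed

section \<open>Points on the parabola\<close>

definition parab :: "real \<Rightarrow> point" where
  "parab u = vector [u, u\<^sup>2]"

lemma parab_nth [simp]: "parab u $ 1 = u" "parab u $ 2 = u\<^sup>2"
  by (simp_all add: parab_def)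

lemma parab_eq_iff [simp]: "parab u = parab v \<longleftrightarrow> u = v"
  by (metis parab_nth(1))

text \<open>A Vandermonde determinant. For increasing parameters it is positive, which gives general
  position and convex position at once.\<close>

lemma orient_parab: "orient (parab u) (parab v) (parab w) = (v - u) * (w - u) * (w - v)"
  by (simp add: orient_def algebra_simps power2_eq_square)

lemma parab_chords_meet:
  assumes "a < b" "b < c" "c < d"
  shows "closed_segment (parab a) (parab c) \<inter> closed_segment (parab b) (parab d) \<noteq> {}"
  by (rule segments_meet)
    (use assms in \<open>auto simp: orient_parab mult_less_0_iff zero_less_mult_iff\<close>)

section \<open>The maxima in the definitions\<close>

lemma finite_card_values: "finite {card X | X. X \<subseteq> S \<and> Q X}" if "finite S"
proof -
  have "{card X | X. X \<subseteq> S \<and> Q X} \<subseteq> card ` Pow S" by auto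
  then show ?thesis using that finite_subset by blast
qed

lemma K13_coverable_empty: "K13_coverable R B {}"
  unfolding K13_coverable_def
  by (rule exI[of _ "{}"]) (auto simp: noncrossing_def partition_on_def)

lemma covered_attained:
  assumes "finite R" "finite B"
  obtains X where "X \<subseteq> R \<union> B" "K13_coverable R B X" "card X = covered R B"
proof -
  let ?S = "{card X | X. X \<subseteq> R \<union> B \<and> K13_coverable R B X}"
  have "covered R B \<in> ?S" unfolding covered_def
    by (rule Max_in) (use assms finite_card_values[of "R \<union> B"] K13_coverable_empty in auto)
  then show ?thesis using that by auto
qed

lemma card_le_covered:
  assumes "finite R" "finite B" "X \<subseteq> R \<union> B" "K13_coverable R B X"
  shows "card X \<le> covered R B"
  unfolding covered_def by (rule Max_ge) (use assms finite_card_values[of "R \<union> B"] in auto)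

lemma uncovered_eq_0_iff:
  assumes "finite R" "finite B"
  shows "uncovered R B = 0 \<longleftrightarrow> K13_coverable R B (R \<union> B)"
proof
  obtain X where X: "X \<subseteq> R \<union> B" "K13_coverable R B X" "card X = covered R B"
    using covered_attained assms by blast
  assume "uncovered R B = 0"
  \<comment> \<open>Subtraction on \<open>nat\<close> is truncated, so the value 0 yields only this
    inequality; it suffices since \<open>X\<close> is a subset.\<close>
  then have "card (R \<union> B) \<le> card X" using X by (simp add: uncovered_def)
  then have "X = R \<union> B" using X(1) assms by (meson card_seteq finite_UnI)
  then show "K13_coverable R B (R \<union> B)" using X by simp
next
  assume "K13_coverable R B (R \<union> B)"
  then show "uncovered R B = 0"
    using card_le_covered[OF assms order_refl] by (simp add: uncovered_def)
qed

lemma finite_uncovered_values: "finite {uncovered R B | R B. rb_set r b R B}"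
proof (rule finite_subset)
  show "{uncovered R B | R B. rb_set r b R B} \<subseteq> {..r + b}"
    by (auto simp: rb_set_def uncovered_def card_Un_disjoint)
qed simp

lemma uncovered_le_max_uncovered: "rb_set r b R B \<Longrightarrow> uncovered R B \<le> max_uncovered r b"
  unfolding max_uncovered_def by (rule Max_ge[OF finite_uncovered_values]) auto

lemma K13_coverable_commute: "K13_coverable R B X \<longleftrightarrow> K13_coverable B R X"
  unfolding K13_coverable_def by (simp add: disj_commute)

lemma uncovered_commute: "uncovered R B = uncovered B R"
  by (simp add: uncovered_def covered_def Un_commute K13_coverable_commute)

lemma rb_set_commute: "rb_set r b R B \<longleftrightarrow> rb_set b r B R"
  by (auto simp: rb_set_def Un_commute Int_commute)

lemma max_uncovered_commute: "max_uncovered r b = max_uncovered b r"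
proof -
  have "{uncovered R B | R B. rb_set r b R B} = {uncovered R B | R B. rb_set b r R B}"
    using uncovered_commute rb_set_commute by blast
  then show ?thesis by (simp add: max_uncovered_def)
qed

lemma general_position_parab: "general_position ((\<lambda>i. parab (real i)) ` {..<n})"
  by (rule general_position_image) (simp add: orient_parab)

lemma rb_set_parab:
  assumes "J \<subseteq> {..<n}"
  shows "rb_set (n - card J) (card J)
    ((\<lambda>i. parab (real i)) ` ({..<n} - J)) ((\<lambda>i. parab (real i)) ` J)"
proof -
  let ?pt = "\<lambda>i. parab (real i)"
  have inj: "inj_on ?pt A" for A by (auto intro: inj_onI)
  have fin: "finite J" using assms finite_subset by blast
  have "?pt ` ({..<n} - J) \<union> ?pt ` J = ?pt ` {..<n}" using assms by auto
  then show ?thesis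
    using general_position_parab[of n] fin assms
    by (auto simp: rb_set_def card_image[OF inj] card_Diff_subset)
qed

text \<open>Makes the set under \<open>Max\<close> in \<open>max_uncovered\<close> nonempty, so that
  the maximum is attained.\<close>

lemma rb_set_exists: "\<exists>R B. rb_set r b R B"
  using rb_set_parab[of "{..<b}" "r + b"] by auto

lemma max_uncovered_attained:
  obtains R B where "rb_set r b R B" "uncovered R B = max_uncovered r b"
proof -
  have "max_uncovered r b \<in> {uncovered R B | R B. rb_set r b R B}" unfolding max_uncovered_def
    by (rule Max_in[OF finite_uncovered_values]) (use rb_set_exists in auto)
  then show ?thesis using that by auto
qed

section \<open>Shortest assignments\<close>

lemma general_position_not_collinear:
  assumes "general_position S" "{a, b, c} \<subseteq> S" "a \<noteq> b" "a \<noteq> c" "b \<noteq> c"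
  shows "\<not> collinear {a, b, c}"
  using assms unfolding general_position_def by (metis card_3_iff)

text \<open>A second common point \<open>x\<close> would put both \<open>p\<close> and
  \<open>q\<close> on the line through \<open>c\<close> and \<open>x\<close>.\<close>

lemma segments_from_common_endpoint:
  fixes c p q :: "'a::euclidean_space"
  assumes "\<not> collinear {c, p, q}"
  shows "closed_segment c p \<inter> closed_segment c q \<subseteq> {c}"
proof (rule ccontr)
  assume "\<not> ?thesis"
  then obtain x where x: "x \<in> closed_segment c p" "x \<in> closed_segment c q" "x \<noteq> c" by blast
  then have "collinear {c, x, p}" "collinear {c, x, q}"
    by (simp_all add: between_imp_collinear between_mem_segment)
  then have "collinear {p, c, q}" using x(3)
    by (intro collinear_3_trans[of p c x q]) (simp_all add: insert_commute)
  then have "collinear {c, p, q}" by (simp add: insert_commute)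
  then show False using assms by simp
qed

text \<open>Apply the triangle inequality twice at a common point \<open>x\<close> of the two
  segments. Equality for the new segment from \<open>c\<^sub>1\<close> to \<open>p\<^sub>2\<close>
  would put \<open>x\<close> on it as well, so \<open>x = c\<^sub>1\<close>, and then three points
  would be collinear.\<close>

lemma swap_shortens:
  fixes c\<^sub>1 c\<^sub>2 p\<^sub>1 p\<^sub>2 :: point
  assumes "general_position S" "{c\<^sub>1, c\<^sub>2, p\<^sub>1, p\<^sub>2} \<subseteq> S" "card {c\<^sub>1, c\<^sub>2, p\<^sub>1, p\<^sub>2} = 4"
    and "closed_segment c\<^sub>1 p\<^sub>1 \<inter> closed_segment c\<^sub>2 p\<^sub>2 \<noteq> {}"
  shows "dist p\<^sub>1 c\<^sub>2 + dist p\<^sub>2 c\<^sub>1 < dist p\<^sub>1 c\<^sub>1 + dist p\<^sub>2 c\<^sub>2"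
proof -
  have ne: "c\<^sub>1 \<noteq> c\<^sub>2" "c\<^sub>1 \<noteq> p\<^sub>1" "c\<^sub>1 \<noteq> p\<^sub>2" "c\<^sub>2 \<noteq> p\<^sub>1" "c\<^sub>2 \<noteq> p\<^sub>2" "p\<^sub>1 \<noteq> p\<^sub>2"
    using assms(3) by (auto simp: card_insert_if split: if_splits)
  obtain x where x: "x \<in> closed_segment c\<^sub>1 p\<^sub>1" "x \<in> closed_segment c\<^sub>2 p\<^sub>2"
    using assms(4) by blast
  then have d: "dist p\<^sub>1 c\<^sub>1 = dist c\<^sub>1 x + dist x p\<^sub>1" "dist p\<^sub>2 c\<^sub>2 = dist c\<^sub>2 x + dist x p\<^sub>2"
    by (metis between between_mem_segment dist_commute)+
  have tri: "dist p\<^sub>1 c\<^sub>2 \<le> dist c\<^sub>2 x + dist x p\<^sub>1" "dist p\<^sub>2 c\<^sub>1 \<le> dist c\<^sub>1 x + dist x p\<^sub>2"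
    by (metis dist_commute dist_triangle)+
  have "dist p\<^sub>2 c\<^sub>1 \<noteq> dist c\<^sub>1 x + dist x p\<^sub>2"
  proof
    assume "dist p\<^sub>2 c\<^sub>1 = dist c\<^sub>1 x + dist x p\<^sub>2"
    then have x2: "x \<in> closed_segment c\<^sub>1 p\<^sub>2" by (metis between between_mem_segment dist_commute)
    have "closed_segment c\<^sub>1 p\<^sub>1 \<inter> closed_segment c\<^sub>1 p\<^sub>2 \<subseteq> {c\<^sub>1}"
      by (rule segments_from_common_endpoint, rule general_position_not_collinear[OF assms(1)])
        (use assms(2) ne in auto)
    then have "x = c\<^sub>1" using x(1) x2 by blast
    then have "collinear {c\<^sub>2, c\<^sub>1, p\<^sub>2}" using x(2)
      by (simp add: between_imp_collinear between_mem_segment)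
    moreover have "\<not> collinear {c\<^sub>2, c\<^sub>1, p\<^sub>2}"
      by (rule general_position_not_collinear[OF assms(1)]) (use assms(2) ne in auto)
    ultimately show False by simp
  qed
  then show ?thesis using d tri by linarith
qed

text \<open>Extensional functions make this set finite, so that a shortest assignment
  exists.\<close>

definition triple_assignments :: "point set \<Rightarrow> point set \<Rightarrow> (point \<Rightarrow> point) set" where
  "triple_assignments R B = {f \<in> R \<rightarrow>\<^sub>E B. \<forall>c\<in>B. card {q\<in>R. f q = c} = 3}"

lemma finite_triple_assignments: "finite R \<Longrightarrow> finite B \<Longrightarrow> finite (triple_assignments R B)"
  unfolding triple_assignments_def by (simp add: finite_PiE)

lemma triple_assignments_nonempty:
  assumes "finite R" "finite B" "card R = 3 * card B"
  shows "triple_assignments R B \<noteq> {}"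
proof -
  obtain g where g: "bij_betw g R {..<3 * card B}"
    using assms by (metis finite_same_card_bij card_lessThan finite_lessThan)
  obtain h where h: "bij_betw h {..<card B} B"
    using assms by (metis finite_same_card_bij card_lessThan finite_lessThan)
  \<comment> \<open>Number both colours; the red points numbered \<open>3*j\<close>,
    \<open>3*j+1\<close>, \<open>3*j+2\<close> go to the blue point numbered
    \<open>j\<close>.\<close>
  define f where "f = restrict (\<lambda>q. h (g q div 3)) R"
  have lt: "g q div 3 < card B" if "q \<in> R" for q
    using bij_betwE[OF g] that by (auto simp: less_mult_imp_div_less mult.commute)
  have "f \<in> R \<rightarrow>\<^sub>E B" unfolding f_def
    using lt bij_betwE[OF h] by auto
  moreover have "card {q\<in>R. f q = c} = 3" if "c \<in> B" for c
  proof -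
    obtain j where j: "j < card B" "c = h j"
      using h \<open>c \<in> B\<close> by (auto simp: bij_betw_def)
    have "g ` {q\<in>R. f q = c} = {3*j, 3*j+1, 3*j+2}"
    proof (intro equalityI subsetI)
      fix y assume "y \<in> g ` {q\<in>R. f q = c}"
      then obtain q where q: "q \<in> R" "h (g q div 3) = h j" "y = g q"
        using j by (auto simp: f_def)
      then have "g q div 3 = j"
        using h lt[OF q(1)] j(1) by (auto simp: bij_betw_def dest: inj_onD)
      then show "y \<in> {3*j, 3*j+1, 3*j+2}" using q by auto
    next
      fix y assume y: "y \<in> {3*j, 3*j+1, 3*j+2}"
      then have "y < 3 * card B" using j by auto
      then obtain q where "q \<in> R" "y = g q" using g by (auto simp: bij_betw_def)
      moreover have "y div 3 = j" using y by auto
      ultimately show "y \<in> g ` {q\<in>R. f q = c}" using j by (auto simp: f_def)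
    qed
    moreover have "inj_on g {q\<in>R. f q = c}"
      using g by (auto simp: bij_betw_def intro: inj_on_subset)
    ultimately show ?thesis using card_image by fastforce
  qed
  ultimately have "f \<in> triple_assignments R B" by (simp add: triple_assignments_def)
  then show ?thesis by blast
qed

text \<open>The transposition maps each fibre of the new assignment bijectively onto the same fibre
  of the old one.\<close>

lemma triple_assignments_swap:
  assumes f: "f \<in> triple_assignments R B" and "p \<in> R" "q \<in> R"
  shows "f \<circ> Transposition.transpose p q \<in> triple_assignments R B"
proof -
  have R: "Transposition.transpose p q x \<in> R \<longleftrightarrow> x \<in> R" for x
    using assms by (auto simp: Transposition.transpose_def)
  have "card {x\<in>R. f (Transposition.transpose p q x) = c} = card {x\<in>R. f x = c}" for c
  proof -
    have "{x\<in>R. f x = c} = Transposition.transpose p q ` {x\<in>R. f (Transposition.transpose p q x) = c}"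
    proof (intro equalityI subsetI)
      fix x assume "x \<in> {x\<in>R. f x = c}"
      then have "Transposition.transpose p q x \<in> {x\<in>R. f (Transposition.transpose p q x) = c}"
        by (simp add: R)
      then show "x \<in> Transposition.transpose p q ` {x\<in>R. f (Transposition.transpose p q x) = c}"
        by (intro image_eqI[of _ _ "Transposition.transpose p q x"]) simp_all
    qed (auto simp: R)
    then show ?thesis by (simp add: card_image)
  qed
  then show ?thesis using f R
    by (auto simp: triple_assignments_def PiE_def Pi_def extensional_def)
qed

lemma K13_coverable_if_triple:
  assumes rb: "rb_set r b R B" and "r = 3 * b"
  shows "K13_coverable R B (R \<union> B)"
proof -
  have fin: "finite R" "finite B" and RB: "R \<inter> B = {}" and gp: "general_position (R \<union> B)"
    and card: "card R = 3 * card B"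
    using assms by (auto simp: rb_set_def)
  define cost where "cost f = (\<Sum>q\<in>R. dist q (f q))" for f :: "point \<Rightarrow> point"
  obtain f where f: "f \<in> triple_assignments R B"
    and min: "\<And>g. g \<in> triple_assignments R B \<Longrightarrow> cost f \<le> cost g"
    by (rule that[of "arg_min_on cost (triple_assignments R B)"])
      (simp_all add: arg_min_if_finite(1) arg_min_least
        finite_triple_assignments[OF fin] triple_assignments_nonempty[OF fin card])
  have fB: "f q \<in> B" if "q \<in> R" for q using f that by (auto simp: triple_assignments_def)
  have fib: "card {q\<in>R. f q = c} = 3" if "c \<in> B" for c
    using f that by (auto simp: triple_assignments_def)
  \<comment> \<open>Minimality of the cost: swapping \<open>p\<close> and \<open>q\<close> changes
    only two summands, and a crossing would make their sum smaller.\<close>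
  have disj: "closed_segment (f p) p \<inter> closed_segment (f q) q = {}"
    if pq: "p \<in> R" "q \<in> R" "f p \<noteq> f q" for p q
  proof (rule ccontr)
    assume meet: "closed_segment (f p) p \<inter> closed_segment (f q) q \<noteq> {}"
    let ?g = "f \<circ> Transposition.transpose p q"
    have "p \<noteq> q" using pq by auto
    have "card {f p, f q, p, q} = 4" using pq fB[OF pq(1)] fB[OF pq(2)] RB \<open>p \<noteq> q\<close>
      by (auto simp: card_insert_if)
    then have less: "dist p (f q) + dist q (f p) < dist p (f p) + dist q (f q)"
      by (intro swap_shortens[OF gp _ _ meet]) (use pq fB in auto)
    have split: "cost h = dist p (h p) + (dist q (h q) + (\<Sum>x\<in>R - {p} - {q}. dist x (h x)))" for h
      unfolding cost_def using fin(1) pq \<open>p \<noteq> q\<close>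
      by (simp add: sum.remove[of R p] sum.remove[of "R - {p}" q])
    have "(\<Sum>x\<in>R - {p} - {q}. dist x (?g x)) = (\<Sum>x\<in>R - {p} - {q}. dist x (f x))"
      by (rule sum.cong) (auto simp: Transposition.transpose_def)
    then have "cost ?g < cost f" using less unfolding split by simp
    moreover have "cost f \<le> cost ?g" using min triple_assignments_swap[OF f pq(1,2)] by simp
    ultimately show False by simp
  qed
  define star where "star c = insert c {q\<in>R. f q = c}" for c
  \<comment> \<open>A star has exactly one blue point, so its centre can be recovered from the set
    alone.\<close>
  define ctr where "ctr Y = (THE c. c \<in> Y \<inter> B)" for Y
  have ctr: "ctr (star c) = c" if "c \<in> B" for c
    unfolding ctr_def by (rule the_equality) (use that RB in \<open>auto simp: star_def\<close>)
  have rest: "star c - {c} = {q\<in>R. f q = c}" if "c \<in> B" for c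
    using that RB by (auto simp: star_def)
  have "partition_on (R \<union> B) (star ` B)"
    by (rule partition_onI) (use fB RB in \<open>auto simp: star_def disjnt_def\<close>)
  moreover have "\<forall>Y\<in>star ` B. card Y = 4 \<and> ctr Y \<in> Y \<and>
        (ctr Y \<in> R \<and> Y - {ctr Y} \<subseteq> B \<or> ctr Y \<in> B \<and> Y - {ctr Y} \<subseteq> R)"
  proof
    fix Y assume "Y \<in> star ` B"
    then obtain c where c: "c \<in> B" "Y = star c" by blast
    have "card Y = 4" unfolding c star_def using c(1) RB fib[OF c(1)] fin by (subst card_insert_disjoint) auto
    then show "card Y = 4 \<and> ctr Y \<in> Y \<and>
        (ctr Y \<in> R \<and> Y - {ctr Y} \<subseteq> B \<or> ctr Y \<in> B \<and> Y - {ctr Y} \<subseteq> R)"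
      using c ctr[OF c(1)] rest[OF c(1)] by (auto simp: star_def)
  qed
  moreover have "noncrossing {(ctr Y, q) | Y q. Y \<in> star ` B \<and> q \<in> Y - {ctr Y}}"
  proof -
    have E: "{(ctr Y, q) | Y q. Y \<in> star ` B \<and> q \<in> Y - {ctr Y}} = {(f q, q) | q. q \<in> R}"
    proof (intro equalityI subsetI)
      fix e assume "e \<in> {(ctr Y, q) | Y q. Y \<in> star ` B \<and> q \<in> Y - {ctr Y}}"
      then obtain c q where "c \<in> B" "q \<in> star c - {c}" "e = (c, q)" by (auto simp: ctr)
      then show "e \<in> {(f q, q) | q. q \<in> R}" using rest by auto
    next
      fix e assume "e \<in> {(f q, q) | q. q \<in> R}"
      then obtain q where q: "q \<in> R" "e = (f q, q)" by blast
      then have "q \<in> star (f q) - {ctr (star (f q))}" "e = (ctr (star (f q)), q)"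
        "star (f q) \<in> star ` B" using rest fB ctr by auto
      then show "e \<in> {(ctr Y, q) | Y q. Y \<in> star ` B \<and> q \<in> Y - {ctr Y}}"
        by blast
    qed
    \<comment> \<open>Edges at one centre are handled by general position, edges at different
      centres by minimality.\<close>
    have "closed_segment (f p) p \<inter> closed_segment (f q) q \<subseteq> {f p, p} \<inter> {f q, q}"
      if pq: "p \<in> R" "q \<in> R" "p \<noteq> q" for p q
    proof (cases "f p = f q")
      case True
      have "closed_segment (f p) p \<inter> closed_segment (f p) q \<subseteq> {f p}"
        by (rule segments_from_common_endpoint, rule general_position_not_collinear[OF gp])
          (use pq fB[OF pq(1)] RB in auto)
      then show ?thesis using True by auto
    next
      case False
      then show ?thesis using disj pq by simp
    qed
    then show ?thesis unfolding E noncrossing_def by auto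
  qed
  ultimately show ?thesis unfolding K13_coverable_def by blast
qed

lemma max_uncovered_if_triple:
  assumes "r = 3 * b"
  shows "max_uncovered r b = 0"
proof -
  obtain R B where "rb_set r b R B" "uncovered R B = max_uncovered r b"
    using max_uncovered_attained by blast
  then show ?thesis
    using K13_coverable_if_triple[OF _ assms] uncovered_eq_0_iff by (metis rb_set_def)
qed

section \<open>Stars on indexed point sets\<close>

text \<open>Symmetric in its arguments, because a centre may have a smaller or a larger index than
  its leaf.\<close>

definition betw :: "nat \<Rightarrow> nat \<Rightarrow> nat set" where
  "betw x y = {min x y<..<max x y}"

text \<open>Convex position enters the combinatorial arguments only through this crossing of
  diagonals.\<close>

definition convex_chain :: "nat \<Rightarrow> (nat \<Rightarrow> point) \<Rightarrow> bool" where
  "convex_chain n pt \<longleftrightarrow> (\<forall>a b c d. a < b \<longrightarrow> b < c \<longrightarrow> c < d \<longrightarrow> d < n \<longrightarrow>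
     closed_segment (pt a) (pt c) \<inter> closed_segment (pt b) (pt d) \<noteq> {})"

lemma convex_chain_meet:
  assumes ch: "convex_chain n pt" and "x < n" "y < n" "u < n" "v < n" "u \<in> betw x y"
    "v \<notin> betw x y" "v \<noteq> x" "v \<noteq> y"
  shows "closed_segment (pt x) (pt y) \<inter> closed_segment (pt u) (pt v) \<noteq> {}"
proof -
  have *: "closed_segment (pt x) (pt y) \<inter> closed_segment (pt u) (pt v) \<noteq> {}"
    if "x < u" "u < y" "v < x \<or> y < v" "x < n" "y < n" "u < n" "v < n" for x y
    using that(3)
  proof
    assume "v < x"
    then have "closed_segment (pt v) (pt u) \<inter> closed_segment (pt x) (pt y) \<noteq> {}"
      using ch that unfolding convex_chain_def by blast
    then show ?thesis by (metis closed_segment_commute inf_commute)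
  next
    assume "y < v"
    then show ?thesis using ch that unfolding convex_chain_def by blast
  qed
  show ?thesis
  proof (cases "x < y")
    case True
    then show ?thesis using assms by (intro *) (auto simp: betw_def)
  next
    case False
    then show ?thesis using assms *[of y x] by (auto simp: betw_def closed_segment_commute)
  qed
qed

text \<open>Points are addressed by their indices: \<open>I\<close> is the set of covered indices, \<open>A\<close> contains the red
  ones, and \<open>z Y\<close> is the centre of the star \<open>Y\<close>. The stars are vertex-disjoint, so edges of different
  stars have no point in common at all.\<close>

locale star_cover =
  fixes pt :: "nat \<Rightarrow> point" and A I :: "nat set" and Q :: "nat set set" and z :: "nat set \<Rightarrow> nat"
  assumes part: "partition_on I Q" and fin: "finite I"
    and card4: "Y \<in> Q \<Longrightarrow> card Y = 4"
    and ctr: "Y \<in> Q \<Longrightarrow> z Y \<in> Y"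
    and colour: "Y \<in> Q \<Longrightarrow> q \<in> Y \<Longrightarrow> q \<noteq> z Y \<Longrightarrow> q \<in> A \<longleftrightarrow> z Y \<notin> A"
    and disj: "Y \<in> Q \<Longrightarrow> W \<in> Q \<Longrightarrow> Y \<noteq> W \<Longrightarrow> p \<in> Y \<Longrightarrow> p \<noteq> z Y \<Longrightarrow> q \<in> W \<Longrightarrow> q \<noteq> z W \<Longrightarrow>
      closed_segment (pt (z Y)) (pt p) \<inter> closed_segment (pt (z W)) (pt q) = {}"
begin

lemma finQ: "finite Q"
  using part fin by (rule finite_elements[rotated])

lemma sub: "Y \<in> Q \<Longrightarrow> Y \<subseteq> I"
  using part by (auto simp: partition_on_def)

lemma finY: "Y \<in> Q \<Longrightarrow> finite Y"
  using sub fin finite_subset by blast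

lemma unique: "Y \<in> Q \<Longrightarrow> W \<in> Q \<Longrightarrow> x \<in> Y \<Longrightarrow> x \<in> W \<Longrightarrow> Y = W"
  using part by (meson disjointD partition_on_def disjoint_iff)

lemma obtain_star:
  assumes "x \<in> I"
  obtains Y where "Y \<in> Q" "x \<in> Y"
  using part assms by (auto simp: partition_on_def)

lemma card_Int:
  "card (I \<inter> S) = (\<Sum>Y\<in>Q. card (Y \<inter> S))"
proof -
  have "I \<inter> S = (\<Union>Y\<in>Q. Y \<inter> S)" using part by (auto simp: partition_on_def)
  also have "card \<dots> = (\<Sum>Y\<in>Q. card (Y \<inter> S))"
    by (rule card_UN_disjoint[OF finQ]) (use finY unique in blast)+
  finally show ?thesis .
qed

text \<open>Every star other than \<open>Y\<close> contributes 4 or 0 points to \<open>S\<close>, so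
  modulo 2 only \<open>Y\<close> counts.\<close>

lemma even_card_Int:
  assumes "Y \<in> Q" "\<And>W. W \<in> Q \<Longrightarrow> W \<noteq> Y \<Longrightarrow> W \<subseteq> S \<or> W \<inter> S = {}"
  shows "even (card (I \<inter> S)) \<longleftrightarrow> even (card (Y \<inter> S))"
proof -
  have "even (card (W \<inter> S))" if "W \<in> Q - {Y}" for W
  proof -
    have "W \<in> Q" "W \<noteq> Y" using that by auto
    from assms(2)[OF this] show ?thesis
    proof
      assume "W \<subseteq> S"
      then show ?thesis using card4[OF \<open>W \<in> Q\<close>] by (simp add: Int_absorb2)
    qed simp
  qed
  then have "even (\<Sum>W\<in>Q - {Y}. card (W \<inter> S))" by (rule dvd_sum)
  then show ?thesis
    using sum.remove[OF finQ assms(1), of "\<lambda>Y. card (Y \<inter> S)"] by (simp add: card_Int)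
qed

text \<open>A leaf of \<open>W\<close> on the other side than its centre would be joined to it by an
  edge crossing the given one. The intersection with \<open>{..<n}\<close> allows \<open>W\<close>
  to contain the apex.\<close>

lemma edge_side:
  assumes "convex_chain n pt" "Y \<in> Q" "W \<in> Q" "Y \<noteq> W" "q \<in> Y" "q \<noteq> z Y" "q < n" "z Y < n" "z W < n"
  shows "W \<inter> {..<n} \<subseteq> betw (z Y) q \<or> W \<inter> betw (z Y) q = {}"
proof -
  have same: "w \<in> betw (z Y) q \<longleftrightarrow> z W \<in> betw (z Y) q" if "w \<in> W" "w < n" for w
  proof (rule ccontr)
    assume ne: "\<not> ?thesis"
    then have "w \<noteq> z W" by auto
    have out: "v \<noteq> z Y" "v \<noteq> q" if "v \<in> W" for v
      using that assms(2-5) unique ctr by blast+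
    have "closed_segment (pt (z Y)) (pt q) \<inter> closed_segment (pt (z W)) (pt w) \<noteq> {}"
      using ne convex_chain_meet[OF assms(1), of "z Y" q w "z W"]
        convex_chain_meet[OF assms(1), of "z Y" q "z W" w] out[OF \<open>w \<in> W\<close>] out[OF ctr[OF \<open>W \<in> Q\<close>]]
        assms that by (metis closed_segment_commute)
    then show False using disj[OF assms(2-6) that(1) \<open>w \<noteq> z W\<close>] by blast
  qed
  have "betw (z Y) q \<subseteq> {..<n}" using assms by (auto simp: betw_def)
  then show ?thesis using same by blast
qed

text \<open>The path in \<open>Y\<close> from \<open>a\<close> through the centre to
  \<open>b\<close> separates \<open>c\<close> from \<open>d\<close>, hence one of its edges does;
  but \<open>c\<close> and \<open>d\<close> belong to one star.\<close>

lemma stars_not_interleaved: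
  assumes ch: "convex_chain n pt" and Y: "Y \<in> Q" "Y \<subseteq> {..<n}" and W: "W \<in> Q" "W \<subseteq> {..<n}"
    and ne: "Y \<noteq> W" and "a \<in> Y" "b \<in> Y" "c \<in> W" "d \<in> W" "a < c" "c < b" "b < d"
  shows False
proof -
  have side: "(c \<in> betw (z Y) q) = (d \<in> betw (z Y) q)" if "q \<in> Y" "q \<noteq> z Y" for q
    using edge_side[OF ch Y(1) W(1) ne that] assms ctr that by blast
  have "c \<noteq> z Y" "d \<noteq> z Y" using ctr unique assms by blast+
  then show False
    using side[OF \<open>a \<in> Y\<close>] side[OF \<open>b \<in> Y\<close>] \<open>a < c\<close> \<open>c < b\<close> \<open>b < d\<close>
    by (cases "z Y = a"; cases "z Y = b") (auto simp: betw_def min_def max_def split: if_splits)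
qed

end

section \<open>Parity along the edges of a star\<close>

lemma card_4_nat_sorted:
  assumes "card (Z :: nat set) = 4"
  obtains a b c d where "Z = {a, b, c, d}" "a < b" "b < c" "c < d"
proof -
  define xs where "xs = sorted_list_of_set Z"
  have fin: "finite Z" using assms by (metis card.infinite zero_neq_numeral)
  have "length xs = 4" "sorted_wrt (<) xs" "set xs = Z"
    using assms fin by (simp_all add: xs_def)
  moreover from this(1) obtain a b c d where "xs = [a, b, c, d]"
    by (auto simp: length_Suc_conv numeral_eq_Suc)
  ultimately show ?thesis using that[of a b c d] by auto
qed

lemma card_betw: "x \<noteq> y \<Longrightarrow> even (card (betw x y)) \<longleftrightarrow> odd (x + y)"
  by (cases "x < y") (auto simp: betw_def even_diff_nat)

text \<open>The number of indices between the centre and a leaf has the parity of the number of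
  points of \<open>Z\<close> between them. So index and rank within \<open>Z\<close> change parity
  together, and the four sorted points alternate.\<close>

lemma two_even:
  assumes "card Z = 4" "x \<in> Z"
    and par: "\<And>q. q \<in> Z \<Longrightarrow> q \<noteq> x \<Longrightarrow> even (card (betw x q)) \<longleftrightarrow> even (card (Z \<inter> betw x q))"
  shows "card {i \<in> Z. even i} = 2"
proof -
  obtain a b c d where Z: "Z = {a, b, c, d}" and lt: "a < b" "b < c" "c < d"
    using card_4_nat_sorted[OF assms(1)] .
  have par': "odd (x + q) \<longleftrightarrow> even (card (Z \<inter> betw x q))" if "q \<in> Z" "q \<noteq> x" for q
    using par[OF that] card_betw[of x q] that by auto
  have e: "Z \<inter> betw a b = {}" "Z \<inter> betw b c = {}" "Z \<inter> betw c d = {}"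
    "Z \<inter> betw a c = {b}" "Z \<inter> betw b d = {c}" "Z \<inter> betw a d = {b, c}"
    using lt by (auto simp: Z betw_def)
  have sym: "betw u v = betw v u" for u v by (simp add: betw_def min.commute max.commute)
  have *: "(even a \<longleftrightarrow> odd b) \<and> (even a \<longleftrightarrow> even c) \<and> (even a \<longleftrightarrow> odd d)"
    using par'[of a] par'[of b] par'[of c] par'[of d] assms(2) lt
    by (auto simp: Z e[unfolded Z] sym[of b a] sym[of c a] sym[of d a] sym[of c b] sym[of d b] sym[of d c])
  have "{i \<in> Z. even i} = (if even a then {a, c} else {b, d})" using * by (auto simp: Z)
  then show ?thesis using lt by auto
qed

context star_cover begin

text \<open>Stated for one star, so that it also applies when a vertex is left out:
  \<open>full\<close> asks only that no edge of \<open>Y\<close> passes over an uncovered index, and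
  \<open>sides\<close> treats a star that contains the apex.\<close>

lemma two_even_star:
  assumes ch: "convex_chain n pt" and Y: "Y \<in> Q" "Y \<subseteq> {..<n}"
    and sides: "\<And>W q. W \<in> Q \<Longrightarrow> W \<noteq> Y \<Longrightarrow> \<not> W \<subseteq> {..<n} \<Longrightarrow> q \<in> Y \<Longrightarrow> q \<noteq> z Y \<Longrightarrow> W \<inter> betw (z Y) q = {}"
    and full: "\<And>q. q \<in> Y \<Longrightarrow> betw (z Y) q \<subseteq> I"
  shows "card {i \<in> Y. even i} = 2"
proof (rule two_even[OF card4[OF Y(1)] ctr[OF Y(1)]])
  fix q assume q: "q \<in> Y" "q \<noteq> z Y"
  have "W \<subseteq> betw (z Y) q \<or> W \<inter> betw (z Y) q = {}" if W: "W \<in> Q" "W \<noteq> Y" for W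
  proof (cases "W \<subseteq> {..<n}")
    case True
    then show ?thesis using edge_side[OF ch Y(1) W(1) W(2)[symmetric] q] Y q W ctr by blast
  next
    case False
    then show ?thesis using sides[OF W _ q] by simp
  qed
  from even_card_Int[OF Y(1) this]
  show "even (card (betw (z Y) q)) \<longleftrightarrow> even (card (Y \<inter> betw (z Y) q))"
    using full[OF q(1)] by (simp add: Int_absorb1)
qed

end

section \<open>From covers to indexed stars\<close>

lemma noncrossingD:
  assumes "noncrossing E" "(p, q) \<in> E" "(p', q') \<in> E" "(p, q) \<noteq> (p', q')"
  shows "closed_segment p q \<inter> closed_segment p' q' \<subseteq> {p, q} \<inter> {p', q'}"
  using assms unfolding noncrossing_def by fast

definition K13_cover ::
  "point set \<Rightarrow> point set \<Rightarrow> point set \<Rightarrow> point set set \<Rightarrow> (point set \<Rightarrow> point) \<Rightarrow> bool" where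
  "K13_cover R B X P c \<longleftrightarrow> partition_on X P \<and>
     (\<forall>Y\<in>P. card Y = 4 \<and> c Y \<in> Y \<and>
        (c Y \<in> R \<and> Y - {c Y} \<subseteq> B \<or> c Y \<in> B \<and> Y - {c Y} \<subseteq> R)) \<and>
     noncrossing {(c Y, q) | Y q. Y \<in> P \<and> q \<in> Y - {c Y}}"

lemma K13_coverable_iff: "K13_coverable R B X \<longleftrightarrow> (\<exists>P c. K13_cover R B X P c)"
  by (simp add: K13_coverable_def K13_cover_def)

lemma star_cover_of_K13_cover:
  assumes cover: "K13_cover R B (pt ` I) P c" and inj: "inj_on pt I" and fin: "finite I"
    and RB: "R \<inter> B = {}"
  shows "star_cover pt {i. pt i \<in> R} I ((`) (inv_into I pt) ` P) (\<lambda>Z. inv_into I pt (c (pt ` Z)))"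
proof -
  have P: "partition_on (pt ` I) P"
    and st: "\<And>Y. Y \<in> P \<Longrightarrow> card Y = 4 \<and> c Y \<in> Y \<and>
        (c Y \<in> R \<and> Y - {c Y} \<subseteq> B \<or> c Y \<in> B \<and> Y - {c Y} \<subseteq> R)"
    and nc: "noncrossing {(c Y, q) | Y q. Y \<in> P \<and> q \<in> Y - {c Y}}"
    using cover by (simp_all add: K13_cover_def)
  define g where "g = inv_into I pt"
  define z where "z = (\<lambda>Z. g (c (pt ` Z)))"
  have sub: "Y \<subseteq> pt ` I" if "Y \<in> P" for Y using P that by (auto simp: partition_on_def)
  have pg: "pt (g x) = x" "g x \<in> I" if "x \<in> pt ` I" for x
    unfolding g_def using that by (rule f_inv_into_f, rule inv_into_into)
  have pgY: "pt (g x) = x" if "x \<in> Y" "Y \<in> P" for x Y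
    using sub[OF that(2)] that(1) pg(1) by blast
  have im: "pt ` g ` Y = Y" if "Y \<in> P" for Y
    using pgY[OF _ that] by (simp add: image_image)
  have injg: "inj_on g (pt ` I)" by (auto simp: g_def intro: inj_on_inv_into)
  have bij: "g ` pt ` I = I" unfolding g_def using inj by (simp add: image_image)
  have dj: "x \<notin> W" if "x \<in> Y" "Y \<in> P" "W \<in> P" "Y \<noteq> W" for x Y W
    using P that by (meson disjointD partition_on_def disjoint_iff)
  have "star_cover pt {i. pt i \<in> R} I ((`) g ` P) z"
  proof
    show "partition_on I ((`) g ` P)"
    proof (rule partition_onI)
      show "\<Union> ((`) g ` P) = I" using P bij by (metis image_Union partition_on_def)
      show "{} \<notin> (`) g ` P" using P by (auto simp: partition_on_def)
      fix p q assume "p \<in> (`) g ` P" "q \<in> (`) g ` P" "p \<noteq> q"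
      then obtain Y W where YW: "p = g ` Y" "q = g ` W" "Y \<in> P" "W \<in> P" "Y \<noteq> W" by blast
      then have "Y \<inter> W = {}" using dj by blast
      then have "g ` Y \<inter> g ` W = {}"
        using injg sub YW by (metis image_empty inj_on_image_Int)
      then show "disjnt p q" using YW by (simp add: disjnt_def)
    qed
  next
    show "finite I" by fact
  next
    fix Z assume "Z \<in> (`) g ` P"
    then obtain Y where Y: "Y \<in> P" "Z = g ` Y" by blast
    have zZ: "z Z = g (c Y)" using Y im by (simp add: z_def)
    show "card Z = 4" using Y st inj_on_subset[OF injg sub[OF Y(1)]] by (simp add: card_image)
    show "z Z \<in> Z" using zZ Y st by simp
    fix q assume "q \<in> Z" "q \<noteq> z Z"
    then obtain x where x: "x \<in> Y" "q = g x" "x \<noteq> c Y" using Y zZ by auto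
    show "q \<in> {i. pt i \<in> R} \<longleftrightarrow> z Z \<notin> {i. pt i \<in> R}"
      using st[OF Y(1)] x zZ pgY[OF _ Y(1)] RB by auto
  next
    fix Z V p q
    assume ZV: "Z \<in> (`) g ` P" "V \<in> (`) g ` P" "Z \<noteq> V"
      and pq: "p \<in> Z" "p \<noteq> z Z" "q \<in> V" "q \<noteq> z V"
    from ZV obtain Y W where YW: "Z = g ` Y" "V = g ` W" "Y \<in> P" "W \<in> P" "Y \<noteq> W" by blast
    have zZ: "z Z = g (c Y)" "z V = g (c W)" using YW im by (simp_all add: z_def)
    obtain x where x: "x \<in> Y" "p = g x" "x \<noteq> c Y" using YW(1) zZ pq(1,2) by auto
    obtain y where y: "y \<in> W" "q = g y" "y \<noteq> c W" using YW(2) zZ pq(3,4) by auto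
    have cc: "c Y \<in> Y" "c W \<in> W" using st YW by auto
    \<comment> \<open>Different parts share no point, so the common endpoints permitted by
      \<open>noncrossing\<close> do not exist and the segments are disjoint.\<close>
    have e: "{c Y, x} \<inter> {c W, y} = {}"
      using dj[OF cc(1) YW(3-5)] dj[OF x(1) YW(3-5)] cc(2) y(1) by auto
    have "(c Y, x) \<in> {(c Y, q) | Y q. Y \<in> P \<and> q \<in> Y - {c Y}}"
      "(c W, y) \<in> {(c Y, q) | Y q. Y \<in> P \<and> q \<in> Y - {c Y}}" using YW(3,4) x y by blast+
    moreover have "(c Y, x) \<noteq> (c W, y)" using e by auto
    ultimately have "closed_segment (c Y) x \<inter> closed_segment (c W) y \<subseteq> {c Y, x} \<inter> {c W, y}"
      by (rule noncrossingD[OF nc])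
    then have "closed_segment (c Y) x \<inter> closed_segment (c W) y = {}" using e by simp
    moreover have "pt (z Z) = c Y" "pt (z V) = c W" "pt p = x" "pt q = y"
      using zZ x y cc pgY YW(3,4) by simp_all
    ultimately show "closed_segment (pt (z Z)) (pt p) \<inter> closed_segment (pt (z V)) (pt q) = {}" by simp
  qed
  then show ?thesis by (simp add: g_def z_def)
qed

lemma K13_coverable_dvd:
  assumes "K13_coverable R B X"
  shows "4 dvd card X"
proof -
  from assms obtain P where P: "partition_on X P" "\<forall>Y\<in>P. card Y = 4"
    unfolding K13_coverable_def by blast
  have "card X = (\<Sum>Y\<in>P. card Y)"
    by (rule product_partition[OF P(1)]) (use P(2) in \<open>auto intro: card_ge_0_finite\<close>)
  then show ?thesis using P(2) by simp
qed

lemma betw_subset: "x < n \<Longrightarrow> y < n \<Longrightarrow> betw x y \<subseteq> {..<n}"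
  by (auto simp: betw_def)

context star_cover begin

lemma card_A_star:
  assumes Y: "Y \<in> Q"
  shows "card (Y \<inter> A) = 1 \<or> card (Y \<inter> A) = 3"
proof (cases "z Y \<in> A")
  case True
  then have "Y \<inter> A = {z Y}" using ctr[OF Y] colour[OF Y] by blast
  then show ?thesis by simp
next
  case False
  then have "Y \<inter> A = Y - {z Y}" using ctr[OF Y] colour[OF Y] by blast
  then show ?thesis using ctr[OF Y] card4[OF Y] finY[OF Y] by simp
qed

text \<open>Two even points would be two points outside \<open>A\<close>, but a star has one or
  three points of each colour.\<close>

lemma not_alternating_star:
  assumes Y: "Y \<in> Q" and "\<And>i. i \<in> Y \<Longrightarrow> i \<in> A \<longleftrightarrow> odd i"
  shows "card {i \<in> Y. even i} \<noteq> 2"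
proof -
  have "{i \<in> Y. even i} = Y - Y \<inter> A" using assms(2) by blast
  then have "card {i \<in> Y. even i} = 4 - card (Y \<inter> A)"
    using card4[OF Y] finY[OF Y] by (simp add: card_Diff_subset)
  then show ?thesis using card_A_star[OF Y] by auto
qed

lemma two_even_full:
  assumes "convex_chain n pt" "I = {..<n}" "Y \<in> Q"
  shows "card {i \<in> Y. even i} = 2"
proof (rule two_even_star[OF assms(1)])
  show "Y \<in> Q" "Y \<subseteq> {..<n}" using assms sub by auto
  show "betw (z Y) q \<subseteq> I" if "q \<in> Y" for q
    using that sub[OF assms(3)] ctr[OF assms(3)] assms(2) betw_subset by blast
qed (use sub assms(2) in blast)

lemma no_alternating_cover:
  assumes "convex_chain n pt" "I = {..<n}" "n > 0" "\<And>i. i < n \<Longrightarrow> i \<in> A \<longleftrightarrow> odd i"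
  shows False
proof -
  obtain Y where Y: "Y \<in> Q" using obtain_star[of 0] assms by auto
  show False using two_even_full[OF assms(1,2) Y] not_alternating_star[OF Y] assms(2,4) sub[OF Y] by blast
qed

lemma card_colours_if_even_A:
  assumes "convex_chain n pt" "I = {..<n}" "\<And>i. i < n \<Longrightarrow> even i \<Longrightarrow> i \<in> A"
  shows "card (I \<inter> A) = 3 * card Q" "card I = 4 * card Q"
proof -
  have "card (Y \<inter> A) = 3" if Y: "Y \<in> Q" for Y
  proof -
    have "{i \<in> Y. even i} \<subseteq> Y \<inter> A" using assms(2,3) sub[OF Y] by auto
    then have "2 \<le> card (Y \<inter> A)"
      using two_even_full[OF assms(1,2) Y] finY[OF Y] by (metis card_mono finite_Int)
    then show ?thesis using card_A_star[OF Y] by auto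
  qed
  then show "card (I \<inter> A) = 3 * card Q" by (simp add: card_Int)
  show "card I = 4 * card Q" using card_Int[of UNIV] card4 by simp
qed

end

section \<open>Necessity in part (a)\<close>

lemma convex_chain_parab:
  assumes "\<And>i j. i < j \<Longrightarrow> j < n \<Longrightarrow> u i < u j" "\<And>i. i < n \<Longrightarrow> pt i = parab (u i)"
  shows "convex_chain n pt"
  unfolding convex_chain_def
proof (intro allI impI)
  fix a b c d assume "a < b" "b < c" "c < d" "d < n"
  then have "u a < u b" "u b < u c" "u c < u d" "pt a = parab (u a)" "pt b = parab (u b)"
    "pt c = parab (u c)" "pt d = parab (u d)"
    using assms by auto
  then show "closed_segment (pt a) (pt c) \<inter> closed_segment (pt b) (pt d) \<noteq> {}"
    using parab_chords_meet by simp
qed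

lemma triple_if_max_uncovered_0:
  assumes "b \<le> r" "max_uncovered r b = 0"
  shows "r = 3 * b"
proof -
  define n where "n = r + b"
  \<comment> \<open>The blue points take the odd positions 1, 3, ..., \<open>2*b-1\<close>, which
    exist because \<open>b \<le> r\<close>; every even position is then red.\<close>
  define J where "J = (\<lambda>i. 2 * i + 1) ` {..<b}"
  define pt where "pt = (\<lambda>i. parab (real i))"
  define R where "R = pt ` ({..<n} - J)"
  define B where "B = pt ` J"
  have J: "J \<subseteq> {..<n}" "card J = b" using assms(1)
    by (auto simp: J_def n_def card_image inj_on_def)
  have rb: "rb_set r b R B"
    using rb_set_parab[OF J(1)] J(2) by (simp add: R_def B_def pt_def n_def)
  have inj: "inj_on pt K" for K by (auto simp: pt_def inj_on_def)
  have "uncovered R B = 0" using uncovered_le_max_uncovered[OF rb] assms(2) by simp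
  then have "K13_coverable R B (R \<union> B)" using uncovered_eq_0_iff rb by (metis rb_set_def)
  moreover have "R \<union> B = pt ` {..<n}" using J(1) by (auto simp: R_def B_def)
  ultimately obtain P c where "K13_cover R B (pt ` {..<n}) P c"
    by (auto simp: K13_coverable_iff)
  then obtain Q z where "star_cover pt {i. pt i \<in> R} {..<n} Q z"
    using star_cover_of_K13_cover[OF _ inj, of R B "{..<n}"] rb by (auto simp: rb_set_def)
  then interpret star_cover pt "{i. pt i \<in> R}" "{..<n}" Q z .
  have mem: "pt i \<in> R \<longleftrightarrow> i \<notin> J" if "i < n" for i
    using that by (auto simp: R_def pt_def)
  have "convex_chain n pt" by (rule convex_chain_parab[of _ real]) (auto simp: pt_def)
  then have "card ({..<n} \<inter> {i. pt i \<in> R}) = 3 * card Q" "card {..<n} = 4 * card Q"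
    by (rule card_colours_if_even_A; use mem in \<open>auto simp: J_def\<close>)+
  moreover have "{..<n} \<inter> {i. pt i \<in> R} = {..<n} - J" using mem by auto
  then have "card ({..<n} \<inter> {i. pt i \<in> R}) = r"
    using J by (simp add: card_Diff_subset finite_subset n_def)
  ultimately show ?thesis by (simp add: n_def)
qed

lemma max_uncovered_eq_0_iff: "max_uncovered r b = 0 \<longleftrightarrow> r = 3 * b \<or> b = 3 * r"
proof
  assume 0: "max_uncovered r b = 0"
  show "r = 3 * b \<or> b = 3 * r"
  proof (cases "b \<le> r")
    case True
    then show ?thesis using triple_if_max_uncovered_0 0 by simp
  next
    case False
    then show ?thesis using triple_if_max_uncovered_0[of r b] 0 max_uncovered_commute[of r b] by simp
  qed
next
  assume "r = 3 * b \<or> b = 3 * r"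
  then show "max_uncovered r b = 0"
    using max_uncovered_if_triple[of r b] max_uncovered_if_triple[of b r] max_uncovered_commute[of r b]
    by auto
qed

section \<open>Covers of the polygon with apex that omit one vertex\<close>

context star_cover begin

text \<open>By \<open>near\<close> and \<open>far\<close>, a chord of span below \<open>2*k\<close>
  cuts the spokes to the vertices inside its index range, a longer one those to the vertices
  outside. Already the two sectors from \<open>a\<close> to \<open>b\<close> and from
  \<open>b\<close> to \<open>c\<close> cannot both contain \<open>p\<close>.\<close>

lemma no_cover_with_apex_centre:
  assumes n: "n = 4 * k" and I: "I = {..n} - {p}"
    and A: "\<And>i. i \<le> n \<Longrightarrow> i \<in> A \<longleftrightarrow> odd i \<or> i = n"
    and Y: "Y \<in> Q" "z Y = n"
    and near: "\<And>l x u. l < x \<Longrightarrow> x < u \<Longrightarrow> u < n \<Longrightarrow> u - l < 2 * k \<Longrightarrow>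
      closed_segment (pt n) (pt x) \<inter> closed_segment (pt l) (pt u) \<noteq> {}"
    and far: "\<And>l x u. l < u \<Longrightarrow> u < n \<Longrightarrow> x < n \<Longrightarrow> x < l \<or> u < x \<Longrightarrow> 2 * k < u - l \<Longrightarrow>
      closed_segment (pt n) (pt x) \<inter> closed_segment (pt l) (pt u) \<noteq> {}"
  shows False
proof -
  have YI: "Y \<subseteq> {..n}" using sub[OF Y(1)] I by auto
  obtain a b c d where Y4: "Y = {a, b, c, d}" "a < b" "b < c" "c < d"
    using card_4_nat_sorted[OF card4[OF Y(1)]] .
  have "d = n" using Y4 YI ctr[OF Y(1)] Y(2) by auto
  have ev: "even i" if "i \<in> Y" "i \<noteq> n" for i
    using colour[OF Y(1) that(1)] that A[of i] A[of n] YI Y(2) by auto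
  have sector: "p \<in> betw a b" if ab: "a \<in> Y" "b \<in> Y" "a < b" "b < n" "Y \<inter> betw a b = {}" for a b
  proof (rule ccontr)
    assume p: "p \<notin> betw a b"
    have cross: "closed_segment (pt n) (pt e) \<inter> closed_segment (pt x) (pt y) = {}"
      if "W \<in> Q" "W \<noteq> Y" "x \<in> W" "y \<in> W" "x \<noteq> y" "x = z W \<or> y = z W" "e = a \<or> e = b" for W x y e
    proof -
      have e: "e \<in> Y" "e \<noteq> z Y" using that(7) ab Y(2) by auto
      note d = disj[OF Y(1) that(1) that(2)[symmetric] e, unfolded Y(2)]
      from that(6) show ?thesis
      proof
        assume "x = z W"
        then show ?thesis using d[of y] that(4,5) by simp
      next
        assume "y = z W"
        then show ?thesis using d[of x] that(3,5) by (simp add: closed_segment_commute)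
      qed
    qed
    have "x \<in> betw a b \<longleftrightarrow> y \<in> betw a b"
      if W: "W \<in> Q" "W \<noteq> Y" and xy: "x \<in> W" "y \<in> W" "x < y" "x = z W \<or> y = z W" for W x y
    proof -
      have out: "x \<noteq> a" "x \<noteq> b" "y \<noteq> a" "y \<noteq> b" "x \<noteq> n" "y \<noteq> n"
        using unique[OF W(1) Y(1)] W(2) xy ab ctr[OF Y(1)] Y(2) by auto
      then have lt: "x < n" "y < n" using sub[OF W(1)] xy I by fastforce+
      \<comment> \<open>An edge joins different colours, so its span is odd and never the undecided
        value \<open>2*k\<close>.\<close>
      have "odd (x + y)" using colour[OF W(1)] xy A[of x] A[of y] lt by fastforce
      then have "y - x \<noteq> 2 * k" using xy(3) by presburger
      then consider "y - x < 2 * k" | "2 * k < y - x" by linarith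
      then show ?thesis
      proof cases
        case 1
        then have "\<not> (x < e \<and> e < y)" if "e = a \<or> e = b" for e
          using near[of x e y] lt cross[OF W xy(1,2) _ xy(4) that] xy(3) by auto
        from this[of a] this[of b] show ?thesis using out ab(3) xy(3) by (auto simp: betw_def)
      next
        case 2
        then have "\<not> (e < x \<or> y < e)" if "e = a \<or> e = b" for e
          using far[of x y e] lt cross[OF W xy(1,2) _ xy(4) that] xy(3) ab(3,4) that by auto
        from this[of a] this[of b] show ?thesis using out ab(3) xy(3) by (auto simp: betw_def)
      qed
    qed
    then have same: "w \<in> betw a b \<longleftrightarrow> z W \<in> betw a b" if "W \<in> Q" "W \<noteq> Y" "w \<in> W" for W w
      using that ctr[OF that(1)] by (metis linorder_neqE_nat)
    have "W \<subseteq> betw a b \<or> W \<inter> betw a b = {}" if "W \<in> Q" "W \<noteq> Y" for W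
      using same[OF that] by blast
    \<comment> \<open>\<open>Y\<close> has no point inside the sector, so the sector has an even
      number of covered vertices; but with \<open>a\<close> and \<open>b\<close> even it contains
      \<open>b - a - 1\<close> vertices, an odd number.\<close>
    then have "even (card (I \<inter> betw a b))" using even_card_Int[OF Y(1)] ab(5) by simp
    moreover have "I \<inter> betw a b = betw a b" using I p ab by (auto simp: betw_def)
    ultimately show False using card_betw[of a b] ev ab by auto
  qed
  have "Y \<inter> betw a b = {}" "Y \<inter> betw b c = {}" using Y4 by (auto simp: betw_def)
  then have "p \<in> betw a b" "p \<in> betw b c" using sector[of a b] sector[of b c] Y4 \<open>d = n\<close> by auto
  then show False using Y4 by (auto simp: betw_def)
qed

lemma no_cover_with_apex_leaf:
  assumes ch: "convex_chain n pt" and n: "n = 4 * k" "k \<ge> 3" and I: "I = {..n} - {p}" "p < n"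
    and A: "\<And>i. i \<le> n \<Longrightarrow> i \<in> A \<longleftrightarrow> odd i \<or> i = n"
    and Y: "Y \<in> Q" "z Y = 0" "n \<in> Y"
    and far: "\<And>l u. 0 < l \<Longrightarrow> l < u \<Longrightarrow> u < n \<Longrightarrow> 2 * k < u - l \<Longrightarrow>
      closed_segment (pt l) (pt u) \<inter> closed_segment (pt 0) (pt n) \<noteq> {}"
  shows False
proof -
  have YI: "Y \<subseteq> {..n}" using sub[OF Y(1)] I by auto
  obtain a b c d where "Y = {a, b, c, d}" "a < b" "b < c" "c < d"
    using card_4_nat_sorted[OF card4[OF Y(1)]] .
  moreover from this have "a = 0" "d = n" using ctr[OF Y(1)] Y(2,3) YI by auto
  ultimately obtain r s where Y4: "Y = {0, r, s, n}" "0 < r" "r < s" "s < n" by blast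
  \<comment> \<open>The centre 0 is even and hence blue, so the leaves \<open>r\<close> and
    \<open>s\<close> are red; being below \<open>n\<close>, they are odd.\<close>
  have rs: "odd r" "odd s"
    using colour[OF Y(1), of r] colour[OF Y(1), of s] Y4 Y(2) A[of 0] A[of r] A[of s] by auto
  have other: "W \<subseteq> {..<n}" "0 \<notin> W" "r \<notin> W" "s \<notin> W" if "W \<in> Q" "W \<noteq> Y" for W
  proof -
    have *: "i \<notin> W" if "i \<in> Y" for i using unique[OF \<open>W \<in> Q\<close> Y(1)] \<open>W \<noteq> Y\<close> that by blast
    show "0 \<notin> W" "r \<notin> W" "s \<notin> W" using *[of 0] *[of r] *[of s] Y4 by auto
    show "W \<subseteq> {..<n}" using sub[OF that(1)] I(1) *[OF Y(3)] by (auto simp: le_less)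
  qed
  have Aodd: "i \<in> A \<longleftrightarrow> odd i" if "i < n" for i using A[of i] that by auto
  \<comment> \<open>The edges of a star on one side of \<open>p\<close> pass over covered indices
    only, so the parity lemma would contradict the alternating colours.\<close>
  have straddle: "(\<exists>x\<in>W. x < p) \<and> (\<exists>y\<in>W. p < y)" if W: "W \<in> Q" "W \<noteq> Y" for W
  proof (rule ccontr)
    assume ns: "\<not> ?thesis"
    have "card {i \<in> W. even i} = 2"
    proof (rule two_even_star[OF ch W(1) other(1)[OF W]])
      fix V q assume V: "V \<in> Q" "\<not> V \<subseteq> {..<n}" and q: "q \<in> W" "q \<noteq> z W"
      \<comment> \<open>Only \<open>Y\<close> leaves the polygon. Its centre 0 lies under no edge of
        \<open>W\<close>, hence neither does any other vertex of \<open>Y\<close>.\<close>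
      have "V = Y" using other V by blast
      moreover have "0 \<in> Y \<inter> {..<n}" "0 \<notin> betw (z W) q" using Y4 by (auto simp: betw_def)
      moreover have "q < n" "z W < n" using other(1)[OF W] q ctr[OF W(1)] by auto
      ultimately show "V \<inter> betw (z W) q = {}"
        using edge_side[OF ch W(1) Y(1) W(2) q] Y(2) Y4 by auto
    next
      fix q assume q: "q \<in> W"
      have zn: "z W < n" "q < n" using other(1)[OF W] q ctr[OF W(1)] by auto
      have "p \<notin> W" using sub[OF W(1)] I by auto
      then have "p \<noteq> q" "p \<noteq> z W" using q ctr[OF W(1)] by auto
      then have "p \<notin> betw (z W) q" using ns q ctr[OF W(1)] by (auto simp: betw_def min_def max_def)
      then show "betw (z W) q \<subseteq> I"
        using betw_subset[of "z W" n q] zn q(1) I by fastforce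
    qed
    then show False using not_alternating_star[OF W(1)] Aodd other(1)[OF W] by blast
  qed
  have star: "\<exists>W\<in>Q. W \<noteq> Y \<and> i \<in> W" if "i \<le> n" "i \<noteq> p" "i \<notin> Y" for i
    using obtain_star[of i] that I by (metis DiffI atMost_iff singletonD)
  have rside: "W \<subseteq> {0<..<r} \<or> W \<inter> {0<..<r} = {}" "W \<subseteq> {0<..<s} \<or> W \<inter> {0<..<s} = {}"
    if W: "W \<in> Q" "W \<noteq> Y" for W
  proof -
    have "z W < n" using other(1)[OF W] ctr[OF W(1)] by blast
    then show "W \<subseteq> {0<..<r} \<or> W \<inter> {0<..<r} = {}" "W \<subseteq> {0<..<s} \<or> W \<inter> {0<..<s} = {}"
      using edge_side[OF ch Y(1) W(1) W(2)[symmetric], of r]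
        edge_side[OF ch Y(1) W(1) W(2)[symmetric], of s] Y4 Y(2) other(1)[OF W]
      by (auto simp: betw_def Int_absorb2)
  qed
  \<comment> \<open>Both are odd, so \<open>r + 1\<close> lies strictly between them. Its star must
    straddle \<open>p\<close>, which the edges from 0 to \<open>r\<close> and to \<open>s\<close>
    permit only if \<open>r < p < s\<close>.\<close>
  have "s \<noteq> r + 1" using rs by auto
  then have r1: "r < r + 1" "r + 1 < s" using Y4 by auto
  have p_out: "p \<noteq> r" "p \<noteq> s" "p \<noteq> 0" using sub[OF Y(1)] Y4 I by auto
  have "r < p"
  proof (rule ccontr)
    assume "\<not> r < p"
    then have "p < r" using p_out by simp
    then obtain W where W: "W \<in> Q" "W \<noteq> Y" "r + 1 \<in> W" using star[of "r + 1"] r1 Y4 by auto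
    then obtain x where "x \<in> W" "x < p" using straddle by blast
    moreover have "x \<noteq> 0" using \<open>x \<in> W\<close> other(2)[OF W(1,2)] by metis
    ultimately show False using rside(1)[OF W(1,2)] W(3) \<open>p < r\<close> by auto
  qed
  have "p < s"
  proof (rule ccontr)
    assume "\<not> p < s"
    then have "s < p" using p_out by simp
    then obtain W where W: "W \<in> Q" "W \<noteq> Y" "r + 1 \<in> W" using star[of "r + 1"] r1 Y4 by auto
    then obtain x where "x \<in> W" "p < x" using straddle by blast
    then show False using rside(2)[OF W(1,2)] W(3) \<open>s < p\<close> r1 by auto
  qed
  \<comment> \<open>A star straddling \<open>p\<close> has a point above \<open>r\<close> and one
    between 0 and \<open>s\<close>; the edges from 0 to \<open>r\<close> and to \<open>s\<close>
    then confine all of it.\<close>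
  have in_rs: "W \<subseteq> {r<..<s}" if W: "W \<in> Q" "W \<noteq> Y" for W
  proof -
    obtain x y where "x \<in> W" "x < p" "y \<in> W" "p < y" using straddle[OF W] by blast
    moreover have "x \<noteq> 0" using \<open>x \<in> W\<close> other(2)[OF W] by metis
    ultimately have "W \<inter> {0<..<r} = {}" "W \<subseteq> {0<..<s}"
      using rside[OF W] \<open>r < p\<close> \<open>p < s\<close> by fastforce+
    show ?thesis
    proof
      fix i assume "i \<in> W"
      then have "i \<in> {0<..<s}" "i \<notin> {0<..<r}" "i \<noteq> r"
        using \<open>W \<inter> {0<..<r} = {}\<close> \<open>W \<subseteq> {0<..<s}\<close> other(3)[OF W] by blast+
      then show "i \<in> {r<..<s}" by auto
    qed
  qed
  \<comment> \<open>A vertex outside \<open>{r<..<s}\<close> other than 0, \<open>r\<close>,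
    \<open>s\<close> would be covered by a star that cannot reach it.\<close>
  have "r = 1"
  proof (rule ccontr)
    assume "r \<noteq> 1"
    then obtain W where "W \<in> Q" "W \<noteq> Y" "1 \<in> W" using star[of 1] Y4 \<open>r < p\<close> n by auto
    then have "1 \<in> {r<..<s}" using in_rs by blast
    then show False using Y4 by simp
  qed
  have "s = n - 1"
  proof (rule ccontr)
    assume "s \<noteq> n - 1"
    moreover from this have "n - 1 \<noteq> p" "n - 1 \<notin> Y" using Y4 \<open>p < s\<close> by auto
    ultimately obtain W where "W \<in> Q" "W \<noteq> Y" "n - 1 \<in> W" using star[of "n - 1"] by auto
    then have "n - 1 \<in> {r<..<s}" using in_rs by blast
    then show False using Y4 by auto
  qed
  have n12: "12 \<le> n" using n by simp
  then have lt: "2 < n - 1" "3 < n - 1" "1 < n - 2" "n - 2 < n - 1" "1 < n - 3" "n - 3 < n - 1"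
    "n - 3 \<noteq> n - 2"
    by auto
  have star': "\<exists>W\<in>Q. W \<noteq> Y \<and> i \<in> W" if "1 < i" "i < n - 1" "i \<noteq> p" for i
    using star[of i] Y4 \<open>r = 1\<close> \<open>s = n - 1\<close> that by auto
  \<comment> \<open>Otherwise the star of 3 would need a vertex strictly between 1 and 2. The case
    \<open>n - 2\<close> is the mirror image.\<close>
  have "p \<noteq> 2"
  proof
    assume "p = 2"
    then obtain W where W: "W \<in> Q" "W \<noteq> Y" "3 \<in> W"
      using star'[of 3] lt n12 by auto
    then obtain x where "x \<in> W" "x < p" using straddle by blast
    then show False using in_rs[OF W(1,2)] \<open>p = 2\<close> \<open>r = 1\<close> by auto
  qed
  have "p \<noteq> n - 2"
  proof
    assume "p = n - 2"
    then obtain W where W: "W \<in> Q" "W \<noteq> Y" "n - 3 \<in> W"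
      using star'[of "n - 3"] lt n12 by auto
    then obtain x where "x \<in> W" "p < x" using straddle by blast
    moreover from this have "x \<in> {r<..<s}" using in_rs[OF W(1,2)] by blast
    ultimately show False using \<open>p = n - 2\<close> \<open>s = n - 1\<close> by auto
  qed
  obtain W where W: "W \<in> Q" "W \<noteq> Y" "2 \<in> W"
    using star'[of 2] lt \<open>p \<noteq> 2\<close> n12 by auto
  obtain V where V: "V \<in> Q" "V \<noteq> Y" "n - 2 \<in> V"
    using star'[of "n - 2"] lt \<open>p \<noteq> n - 2\<close> n12 by auto
  \<comment> \<open>Otherwise straddling gives \<open>2 < x < p < y < n - 2\<close> with 2 and
    \<open>y\<close> in \<open>W\<close>, \<open>x\<close> and \<open>n - 2\<close> in
    \<open>V\<close>: interleaved stars.\<close>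
  have "V = W"
  proof (rule ccontr)
    assume "V \<noteq> W"
    obtain y where y: "y \<in> W" "p < y" using straddle[OF W(1,2)] by blast
    obtain x where x: "x \<in> V" "x < p" using straddle[OF V(1,2)] by blast
    have "x \<noteq> 2" "y \<noteq> n - 2" using x y V W \<open>V \<noteq> W\<close> unique by blast+
    moreover have "x \<in> {r<..<s}" "y \<in> {r<..<s}"
      using in_rs[OF V(1,2)] in_rs[OF W(1,2)] x(1) y(1) by blast+
    ultimately have "2 < x" "y < n - 2" using \<open>r = 1\<close> \<open>s = n - 1\<close> by auto
    then show False
      using stars_not_interleaved[OF ch W(1) other(1)[OF W(1,2)] V(1) other(1)[OF V(1,2)] \<open>V \<noteq> W\<close>[symmetric]
          W(3) y(1) x(1) V(3)] x y by simp
  qed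
  then have W2: "n - 2 \<in> W" using V by simp
  have Wn: "i < n" "1 < i" "i < n - 1" if "i \<in> W" for i
  proof -
    have "i \<in> {r<..<s}" using in_rs[OF W(1,2)] that by blast
    then show "i < n" "1 < i" "i < n - 1" using \<open>r = 1\<close> \<open>s = n - 1\<close> by auto
  qed
  have evn: "even n" "even (n - 2)" using n by simp_all
  \<comment> \<open>The even vertices 2 and \<open>n - 2\<close> cannot both be the centre, and an
    even centre has only odd leaves.\<close>
  have zW: "odd (z W)"
  proof
    assume "even (z W)"
    then have oddl: "odd i" if "i \<in> W" "i \<noteq> z W" for i
      using colour[OF W(1) that] Aodd Wn(1) that ctr[OF W(1)] by auto
    have "z W = 2" "z W = n - 2" using evn(2) oddl[OF W(3)] oddl[OF W2] by (metis dvd_refl)+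
    then show False using n12 by simp
  qed
  have leaf: "even i" if "i \<in> W" "i \<noteq> z W" for i
    using colour[OF W(1) that] Aodd Wn(1) that ctr[OF W(1)] zW by auto
  have ends: "2 \<noteq> z W" "n - 2 \<noteq> z W" using zW evn(2) by (metis dvd_refl)+
  \<comment> \<open>A longer edge would cross the edge of \<open>Y\<close> from 0 to the
    apex.\<close>
  have short: "\<not> 2 * k < u - l" if "l < u" "l \<in> W" "u \<in> W" "l = z W \<or> u = z W" for l u
  proof
    assume "2 * k < u - l"
    then have "closed_segment (pt l) (pt u) \<inter> closed_segment (pt 0) (pt n) \<noteq> {}"
      using far[of l u] that Wn by fastforce
    moreover have "closed_segment (pt l) (pt u) \<inter> closed_segment (pt 0) (pt n) = {}"
      using that(4)
    proof
      assume "l = z W"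
      then show ?thesis using disj[OF W(1) Y(1) W(2), of u n] that n Y(2,3) by simp
    next
      assume "u = z W"
      then show ?thesis
        using disj[OF W(1) Y(1) W(2), of l n] that n Y(2,3) by (simp add: closed_segment_commute)
    qed
    ultimately show False by simp
  qed
  have inner: "V \<subseteq> betw (z W) q \<or> V \<inter> betw (z W) q = {}"
    if "V \<in> Q" "V \<noteq> Y" "V \<noteq> W" "q \<in> W" "q \<noteq> z W" for V q
    using edge_side[OF ch W(1) that(1) that(3)[symmetric] that(4,5)] Wn(1) that(4) ctr[OF W(1)]
      other(1)[OF that(1,2)] ctr[OF that(1)] by blast
  have "p \<noteq> z W" using ctr[OF W(1)] sub[OF W(1)] I by auto
  then consider "z W < p" | "p < z W" by linarith
  then show False
  proof cases
    case 1
    \<comment> \<open>Otherwise the star of 3 is caught under the edge from 2 to \<open>z W\<close>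
      and cannot reach beyond \<open>p\<close>. The other case is the mirror image.\<close>
    have "z W = 3"
    proof (rule ccontr)
      assume "z W \<noteq> 3"
      then have "3 < z W" using Wn(2)[OF ctr[OF W(1)]] ends zW by (cases "z W = 2") auto
      then obtain U where U: "U \<in> Q" "U \<noteq> Y" "3 \<in> U"
        using star'[of 3] lt less_trans[OF \<open>3 < z W\<close> 1] by auto
      have "U \<noteq> W" using U(3) leaf[of 3] \<open>z W \<noteq> 3\<close> by auto
      then have "U \<subseteq> betw (z W) 2"
        using inner[OF U(1,2) _ W(3) ends(1)] U(3) \<open>3 < z W\<close> by (auto simp: betw_def)
      moreover obtain y where "y \<in> U" "p < y" using straddle[OF U(1,2)] by blast
      ultimately show False using 1 \<open>3 < z W\<close> by (auto simp: betw_def)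
    qed
    \<comment> \<open>The span is \<open>4*k - 5\<close>, which exceeds \<open>2*k\<close> because
      \<open>k \<ge> 3\<close>.\<close>
    moreover have "3 < n - 2" "2 * k < n - 2 - 3" using n by auto
    ultimately show False using short[of 3 "n - 2"] W2 ctr[OF W(1)] by metis
  next
    case 2
    have "z W = n - 3"
    proof (rule ccontr)
      assume "z W \<noteq> n - 3"
      then have zlt: "z W < n - 3" using Wn(3)[OF ctr[OF W(1)]] ends by auto
      then obtain U where U: "U \<in> Q" "U \<noteq> Y" "n - 3 \<in> U"
        using star'[of "n - 3"] lt less_trans[OF 2 zlt] by auto
      have "odd (n - 3)" using evn n12 by simp
      then have "U \<noteq> W" using U(3) leaf[of "n - 3"] \<open>z W \<noteq> n - 3\<close> by auto
      then have "U \<subseteq> betw (z W) (n - 2)"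
        using inner[OF U(1,2) _ W2 ends(2)] U(3) zlt by (auto simp: betw_def)
      moreover obtain y where "y \<in> U" "y < p" using straddle[OF U(1,2)] by blast
      ultimately show False using 2 zlt by (auto simp: betw_def)
    qed
    moreover have "2 < n - 3" "2 * k < n - 3 - 2" using n by auto
    ultimately show False using short[of 2 "n - 3"] W(3) ctr[OF W(1)] by metis
  qed
qed

end

section \<open>The polygon with an apex\<close>

text \<open>Index \<open>4 k\<close> is the apex. The two conditions say that the segment from a vertex to the apex meets
  each chord that separates them; chords \<open>(l, u)\<close> with \<open>u - l = 2 k\<close> are left open, which makes
  the notion invariant under rotation, and are harmless because their endpoints have equal colours.\<close>

definition apex_config :: "nat \<Rightarrow> (nat \<Rightarrow> point) \<Rightarrow> bool" where
  "apex_config k pt \<longleftrightarrow> convex_chain (4 * k) pt \<and>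
    (\<forall>l x u. l < x \<longrightarrow> x < u \<longrightarrow> u < 4 * k \<longrightarrow> u - l < 2 * k \<longrightarrow>
      closed_segment (pt (4 * k)) (pt x) \<inter> closed_segment (pt l) (pt u) \<noteq> {}) \<and>
    (\<forall>l x u. l < u \<longrightarrow> u < 4 * k \<longrightarrow> x < 4 * k \<longrightarrow> x < l \<or> u < x \<longrightarrow> 2 * k < u - l \<longrightarrow>
      closed_segment (pt (4 * k)) (pt x) \<inter> closed_segment (pt l) (pt u) \<noteq> {})"

definition rot :: "nat \<Rightarrow> nat \<Rightarrow> (nat \<Rightarrow> point) \<Rightarrow> nat \<Rightarrow> point" where
  "rot k s pt i = (if i < 4 * k then pt ((i + s) mod (4 * k)) else pt i)"

text \<open>A chord from \<open>l\<close> to the last vertex becomes one from 0 to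
  \<open>l + 1\<close>: its span turns into the complement in \<open>4*k\<close>. Inside and outside
  are exchanged together with short and long, and span \<open>2*k\<close> is kept.\<close>

lemma apex_config_rot_1:
  assumes cfg: "apex_config k pt"
  shows "apex_config k (rot k 1 pt)"
proof -
  let ?n = "4 * k" and ?q = "rot k 1 pt"
  have ch: "closed_segment (pt a) (pt c) \<inter> closed_segment (pt b) (pt d) \<noteq> {}"
    if "a < b" "b < c" "c < d" "d < ?n" for a b c d
    using cfg that by (auto simp: apex_config_def convex_chain_def)
  have near: "closed_segment (pt ?n) (pt x) \<inter> closed_segment (pt l) (pt u) \<noteq> {}"
    if "l < x" "x < u" "u < ?n" "u - l < 2 * k" for l x u
    using cfg that unfolding apex_config_def by blast
  have far: "closed_segment (pt ?n) (pt x) \<inter> closed_segment (pt l) (pt u) \<noteq> {}"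
    if "l < u" "u < ?n" "x < ?n" "x < l \<or> u < x" "2 * k < u - l" for l x u
    using cfg that unfolding apex_config_def by blast
  have q: "?q i = pt (i + 1)" if "i + 1 < ?n" for i using that by (simp add: rot_def)
  have qn: "?q ?n = pt ?n" by (simp add: rot_def)
  have ql: "?q i = pt 0" if "i + 1 = ?n" for i using that by (simp add: rot_def)
  have "convex_chain ?n ?q" unfolding convex_chain_def
  proof (intro allI impI)
    fix a b c d assume lt: "a < b" "b < c" "c < d" "d < ?n"
    show "closed_segment (?q a) (?q c) \<inter> closed_segment (?q b) (?q d) \<noteq> {}"
    proof (cases "d + 1 = ?n")
      case True
      then show ?thesis using ch[of 0 "a + 1" "b + 1" "c + 1"] lt q ql
        by (simp add: closed_segment_commute inf_commute)
    next
      case False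
      then show ?thesis using ch[of "a + 1" "b + 1" "c + 1" "d + 1"] lt q by simp
    qed
  qed
  moreover have "closed_segment (?q ?n) (?q x) \<inter> closed_segment (?q l) (?q u) \<noteq> {}"
    if lt: "l < x" "x < u" "u < ?n" "u - l < 2 * k" for l x u
  proof (cases "u + 1 = ?n")
    case True
    then have "2 * k < l + 1 - 0" using lt by linarith
    then show ?thesis using True far[of 0 "l + 1" "x + 1"] lt q ql qn
      by (simp add: closed_segment_commute)
  next
    case False
    then show ?thesis using near[of "l + 1" "x + 1" "u + 1"] lt q qn by simp
  qed
  moreover have "closed_segment (?q ?n) (?q x) \<inter> closed_segment (?q l) (?q u) \<noteq> {}"
    if lt: "l < u" "u < ?n" "x < ?n" "x < l \<or> u < x" "2 * k < u - l" for l x u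
  proof (cases "u + 1 = ?n \<or> x + 1 = ?n")
    case True
    then consider "u + 1 = ?n" "x < l" | "x + 1 = ?n" "u < x" using lt by linarith
    then show ?thesis
    proof cases
      case 1
      then have "l + 1 - 0 < 2 * k" using lt by linarith
      then show ?thesis using 1 near[of 0 "x + 1" "l + 1"] lt q ql qn
        by (simp add: closed_segment_commute)
    next
      case 2
      then show ?thesis using far[of "l + 1" "u + 1" 0] lt q ql qn by simp
    qed
  next
    case False
    then show ?thesis using far[of "l + 1" "u + 1" "x + 1"] lt q qn by simp
  qed
  ultimately show ?thesis unfolding apex_config_def by blast
qed

lemma apex_config_rot: "apex_config k pt \<Longrightarrow> apex_config k (rot k s pt)"
proof (induction s)
  case 0
  have "rot k 0 pt = pt" by (auto simp: rot_def)
  then show ?case using 0 by simp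
next
  case (Suc s)
  have "rot k (Suc s) pt = rot k 1 (rot k s pt)"
    by (auto simp: rot_def mod_simps)
  then show ?case using Suc apex_config_rot_1 by simp
qed

lemma rot_surj:
  assumes "s \<le> 4 * k" "i < 4 * k"
  obtains j where "j < 4 * k" "rot k s pt j = pt i"
proof -
  have "((i + (4 * k - s)) mod (4 * k) + s) mod (4 * k) = i"
    using assms by (simp add: mod_simps)
  then show ?thesis using assms that[of "(i + (4 * k - s)) mod (4 * k)"] by (simp add: rot_def)
qed

text \<open>The line through \<open>(u, u\<^sup>2)\<close> and \<open>(0, 1)\<close> meets the parabola again at parameter \<open>-1/u\<close>. The
  parameters are chosen so that the opposites \<open>m + 3/2\<close> of the negative ones interlace with the
  positive ones, as for the centre of a regular polygon.\<close>

definition apex_param :: "nat \<Rightarrow> nat \<Rightarrow> real" where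
  "apex_param k m = (if m < 2 * k then - 1 / (real m + 3 / 2) else real m - real (2 * k) + 1)"

definition apex :: point where "apex = vector [0, 1]"

definition apex_pt :: "nat \<Rightarrow> nat \<Rightarrow> point" where
  "apex_pt k m = (if m < 4 * k then parab (apex_param k m) else apex)"

lemma apex_param_mono:
  assumes "i < j"
  shows "apex_param k i < apex_param k j"
proof -
  have neg: "apex_param k m < 0" if "m < 2 * k" for m
    using that by (simp add: apex_param_def divide_neg_pos)
  have pos: "0 < apex_param k m" if "\<not> m < 2 * k" for m
    using that by (simp add: apex_param_def)
  consider "j < 2 * k" | "i < 2 * k" "\<not> j < 2 * k" | "\<not> i < 2 * k" using assms by linarith
  then show ?thesis
  proof cases
    case 1
    then show ?thesis using assms by (simp add: apex_param_def field_simps)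
  next
    case 2
    then show ?thesis using neg[of i] pos[of j] by simp
  next
    case 3
    then show ?thesis using assms by (simp add: apex_param_def)
  qed
qed

text \<open>The sign of \<open>1 + u * v\<close> thus decides on which side of a chord the apex
  lies.\<close>

lemma orient_parab_apex: "orient (parab u) (parab v) apex = (v - u) * (1 + u * v)"
  by (simp add: orient_def apex_def algebra_simps power2_eq_square)

lemma apex_param_prod:
  assumes "i < j" "j < 4 * k"
  shows "j - i \<le> 2 * k \<Longrightarrow> 0 < 1 + apex_param k i * apex_param k j"
    and "2 * k < j - i \<Longrightarrow> 1 + apex_param k i * apex_param k j < 0"
proof -
  consider "j < 2 * k" | "i < 2 * k" "\<not> j < 2 * k" | "\<not> i < 2 * k" using assms by linarith
  then have "(j - i \<le> 2 * k \<longrightarrow> 0 < 1 + apex_param k i * apex_param k j) \<and>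
    (2 * k < j - i \<longrightarrow> 1 + apex_param k i * apex_param k j < 0)"
  proof cases
    case 1
    then have "0 < apex_param k i * apex_param k j"
      using assms by (simp add: apex_param_def mult_pos_pos)
    then show ?thesis using 1 by auto
  next
    case 2
    \<comment> \<open>The term \<open>1 / 2\<close> keeps the numerator away from 0; at
      \<open>j - i = 2 * k\<close> it is positive.\<close>
    have "1 + apex_param k i * apex_param k j =
      (real i + real (2 * k) + 1 / 2 - real j) / (real i + 3 / 2)"
      using 2 by (simp add: apex_param_def field_simps)
    moreover have "real j \<le> real i + real (2 * k)" if "j - i \<le> 2 * k" using that assms by linarith
    moreover have "real i + real (2 * k) + 1 \<le> real j" if "2 * k < j - i" using that by linarith
    ultimately show ?thesis by (auto simp: divide_neg_pos)
  next
    case 3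
    then have "0 < apex_param k i * apex_param k j" "j - i \<le> 2 * k"
      using assms by (auto simp: apex_param_def intro!: mult_pos_pos)
    then show ?thesis by auto
  qed
  then show "j - i \<le> 2 * k \<Longrightarrow> 0 < 1 + apex_param k i * apex_param k j"
    and "2 * k < j - i \<Longrightarrow> 1 + apex_param k i * apex_param k j < 0" by auto
qed

lemma orient_apex:
  assumes "i < j" "j < 4 * k"
  shows "j - i \<le> 2 * k \<Longrightarrow> 0 < orient (apex_pt k i) (apex_pt k j) apex"
    and "2 * k < j - i \<Longrightarrow> orient (apex_pt k i) (apex_pt k j) apex < 0"
  using apex_param_prod[OF assms] apex_param_mono[OF assms(1), of k] assms
  by (simp_all add: apex_pt_def orient_parab_apex mult_pos_neg)

lemma orient_apex_pt:
  assumes "i < j" "j < l" "l < 4 * k"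
  shows "0 < orient (apex_pt k i) (apex_pt k j) (apex_pt k l)"
  using apex_param_mono[OF assms(1), of k] apex_param_mono[OF assms(2), of k] assms
  by (simp add: apex_pt_def orient_parab)

lemma apex_config_apex_pt: "apex_config k (apex_pt k)"
proof -
  let ?p = "apex_pt k"
  have top: "?p (4 * k) = apex" by (simp add: apex_pt_def)
  have "convex_chain (4 * k) ?p"
    by (rule convex_chain_parab[of _ "apex_param k"]) (auto simp: apex_param_mono apex_pt_def)
  moreover have "closed_segment (?p (4 * k)) (?p x) \<inter> closed_segment (?p l) (?p u) \<noteq> {}"
    if lt: "l < x" "x < u" "u < 4 * k" "u - l < 2 * k" for l x u
  proof (rule segments_meet)
    \<comment> \<open>All three chords are short, so \<open>l\<close> and \<open>u\<close> lie on
      different sides of the line through \<open>x\<close> and the apex.\<close>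
    have "0 < orient (?p l) (?p x) apex" "0 < orient (?p x) (?p u) apex" "0 < orient (?p l) (?p u) apex"
      using orient_apex(1) lt by auto
    moreover have "0 < orient (?p l) (?p x) (?p u)" using orient_apex_pt lt by auto
    moreover have "orient apex (?p x) (?p l) = - orient (?p l) (?p x) apex"
      "orient apex (?p x) (?p u) = orient (?p x) (?p u) apex"
      "orient (?p l) (?p u) (?p x) = - orient (?p l) (?p x) (?p u)"
      by (simp_all add: orient_def algebra_simps)
    ultimately show "orient (?p (4 * k)) (?p x) (?p l) * orient (?p (4 * k)) (?p x) (?p u) < 0"
      "orient (?p l) (?p u) (?p (4 * k)) * orient (?p l) (?p u) (?p x) < 0"
      unfolding top by (simp_all add: mult_pos_neg mult_neg_pos)
  qed
  moreover have "closed_segment (?p (4 * k)) (?p x) \<inter> closed_segment (?p l) (?p u) \<noteq> {}"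
    if lt: "l < u" "u < 4 * k" "x < 4 * k" "x < l \<or> u < x" "2 * k < u - l" for l x u
  proof (rule segments_meet)
    have f: "orient (?p l) (?p u) apex < 0" using orient_apex(2) lt by auto
    have s: "orient apex (?p x) (?p l) = orient (?p x) (?p l) apex"
      "orient apex (?p x) (?p u) = orient (?p x) (?p u) apex"
      "orient (?p x) (?p l) apex = - orient (?p l) (?p x) apex"
      "orient (?p x) (?p u) apex = - orient (?p u) (?p x) apex"
      "orient (?p l) (?p u) (?p x) = orient (?p x) (?p l) (?p u)"
      by (simp_all add: orient_def algebra_simps)
    \<comment> \<open>With \<open>l u\<close> long and \<open>x\<close> outside, the chord from
      \<open>x\<close> to the nearer index is short and the one to the farther index is long, so the
      signs differ again.\<close>
    have "orient apex (?p x) (?p l) * orient apex (?p x) (?p u) < 0 \<and>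
      orient (?p l) (?p u) apex * orient (?p l) (?p u) (?p x) < 0"
    proof (cases "x < l")
      case True
      then have "0 < orient (?p x) (?p l) apex" "orient (?p x) (?p u) apex < 0"
        "0 < orient (?p x) (?p l) (?p u)"
        using orient_apex[of x l k] orient_apex[of x u k] orient_apex_pt[of x l u k] lt by auto
      then show ?thesis unfolding s(1,2,5) using f by (simp add: mult_pos_neg mult_neg_pos)
    next
      case False
      then have "orient (?p l) (?p x) apex < 0" "0 < orient (?p u) (?p x) apex"
        "0 < orient (?p l) (?p u) (?p x)"
        using orient_apex[of l x k] orient_apex[of u x k] orient_apex_pt[of l u x k] lt by auto
      then show ?thesis unfolding s(1-4) using f by (simp add: mult_pos_neg mult_neg_pos)
    qed
    then show "orient (?p (4 * k)) (?p x) (?p l) * orient (?p (4 * k)) (?p x) (?p u) < 0"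
      "orient (?p l) (?p u) (?p (4 * k)) * orient (?p l) (?p u) (?p x) < 0"
      unfolding top by simp_all
  qed
  ultimately show ?thesis unfolding apex_config_def by blast
qed

lemma inj_apex_pt: "inj_on (apex_pt k) {..4 * k}"
proof (rule inj_onI)
  have ne: "apex \<noteq> parab u" for u
  proof
    assume "apex = parab u"
    from arg_cong[OF this, of "\<lambda>p. p $ 1"] arg_cong[OF this, of "\<lambda>p. p $ 2"]
    show False by (simp add: apex_def)
  qed
  have m: "apex_param k i = apex_param k j \<Longrightarrow> i = j" for i j
    by (metis apex_param_mono less_irrefl linorder_neqE_nat)
  fix i j assume "i \<in> {..4 * k}" "j \<in> {..4 * k}" "apex_pt k i = apex_pt k j"
  then show "i = j" using ne m by (auto simp: apex_pt_def split: if_splits) (metis ne)+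
qed

lemma general_position_apex_pt: "general_position (apex_pt k ` {..4 * k})"
proof -
  have "orient (apex_pt k a) (apex_pt k b) (apex_pt k c) \<noteq> 0"
    if "a < b" "b < c" "c < Suc (4 * k)" for a b c
  proof (cases "c < 4 * k")
    case True
    then show ?thesis using orient_apex_pt that by (metis less_irrefl)
  next
    case False
    then have "apex_pt k c = apex" "b < 4 * k" using that by (auto simp: apex_pt_def)
    then show ?thesis using orient_apex[OF that(1), of k] by (cases "b - a \<le> 2 * k") auto
  qed
  then show ?thesis using general_position_image[of "Suc (4 * k)" "apex_pt k"]
    by (simp add: lessThan_Suc_atMost)
qed

section \<open>The lower bound of part (b)\<close>

lemma no_apex_cover:
  fixes k :: nat
  defines "pt \<equiv> apex_pt k"
  defines "R \<equiv> pt ` {i. i \<le> 4 * k \<and> (odd i \<or> i = 4 * k)}" and "B \<equiv> pt ` {i. i < 4 * k \<and> even i}"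
  assumes k: "k \<ge> 3" and p: "p \<le> 4 * k" and cover: "K13_cover R B (pt ` ({..4 * k} - {p})) P c"
  shows False
proof -
  define n where "n = 4 * k"
  have n: "n = 4 * k" "0 < n" "even n" using k by (auto simp: n_def)
  have inj: "inj_on pt {..n}" using inj_apex_pt by (simp add: pt_def n_def)
  have cfg: "apex_config k pt" by (simp add: pt_def apex_config_apex_pt)
  have mem: "pt i \<in> R \<longleftrightarrow> odd i \<or> i = n" "pt i \<in> B \<longleftrightarrow> i < n \<and> even i" if "i \<le> n" for i
    unfolding R_def B_def
    by (subst inj_on_image_mem_iff[OF inj]; use that in \<open>auto simp: n_def\<close>)+
  have RB: "R \<inter> B = {}" unfolding R_def B_def
    by (subst inj_on_image_Int[OF inj, symmetric]) (auto simp: n_def)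
  \<comment> \<open>A cover concerns point sets only, so it can be read through any injective
    numbering \<open>q\<close> of the same points; below this is used for a rotated one.\<close>
  have reindex: "star_cover q {i. q i \<in> R} ({..n} - {j}) ((`) (inv_into ({..n} - {j}) q) ` P)
      (\<lambda>Z. inv_into ({..n} - {j}) q (c (q ` Z)))"
    if "inj_on q {..n}" "q ` ({..n} - {j}) = pt ` ({..n} - {p})" for q j
    by (rule star_cover_of_K13_cover) (use that cover RB n_def in \<open>auto intro: inj_on_subset\<close>)
  have chain: "convex_chain n q" if "apex_config k q" for q
    using that by (simp add: apex_config_def n_def)
  show False
  proof (cases "p = n")
    case True
    then have "{..n} - {p} = {..<n}" by auto
    then interpret star_cover pt "{i. pt i \<in> R}" "{..<n}" "(`) (inv_into {..<n} pt) ` P"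
      "\<lambda>Z. inv_into {..<n} pt (c (pt ` Z))"
      using reindex[OF inj, of p] by simp
    show False by (rule no_alternating_cover[OF chain[OF cfg]]) (use n mem in auto)
  next
    case False
    then have "p < n" using p n by simp
    have P: "partition_on (pt ` ({..n} - {p})) P"
      and st: "\<And>Y. Y \<in> P \<Longrightarrow> c Y \<in> Y \<and>
        (c Y \<in> R \<and> Y - {c Y} \<subseteq> B \<or> c Y \<in> B \<and> Y - {c Y} \<subseteq> R)"
      using cover by (auto simp: K13_cover_def n_def)
    have "pt n \<in> pt ` ({..n} - {p})" using \<open>p < n\<close> by auto
    then have "pt n \<in> \<Union>P" using P by (simp add: partition_on_def)
    then obtain Y where Y: "Y \<in> P" "pt n \<in> Y" by blast
    then have Ysub: "Y \<subseteq> pt ` ({..n} - {p})" using P by (auto simp: partition_on_def)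
    have "c Y \<in> Y" using st Y by blast
    then obtain m where m: "m \<le> n" "m \<noteq> p" "c Y = pt m" using Ysub by auto
    have im: "q ` inv_into K q ` Y = Y" if "Y \<subseteq> q ` K" for q :: "nat \<Rightarrow> point" and K
      using that by (simp add: image_inv_into_cancel)
    show False
    proof (cases "m = n")
      case True
      interpret star_cover pt "{i. pt i \<in> R}" "{..n} - {p}" "(`) (inv_into ({..n} - {p}) pt) ` P"
        "\<lambda>Z. inv_into ({..n} - {p}) pt (c (pt ` Z))"
        using reindex[OF inj] by simp
      show False
      proof (rule no_cover_with_apex_centre[OF n(1) refl])
        show "inv_into ({..n} - {p}) pt ` Y \<in> (`) (inv_into ({..n} - {p}) pt) ` P" using Y by simp
        show "inv_into ({..n} - {p}) pt (c (pt ` inv_into ({..n} - {p}) pt ` Y)) = n"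
          unfolding im[OF Ysub] m(3) True
          by (rule inv_into_f_f) (use inj \<open>p < n\<close> in \<open>auto intro: inj_on_subset\<close>)
      qed (use mem cfg in \<open>auto simp: apex_config_def n_def\<close>)
    next
      case False
      then have "m < n" using m by simp
      have "pt m \<in> B" using st[OF Y(1)] Y(2) m mem[of n] mem[of m] False inj n by (auto simp: inj_on_def)
      then have "even m" using mem m by auto
      \<comment> \<open>Rotation by \<open>m\<close> moves the centre to index 0. As
        \<open>m\<close> and \<open>n\<close> are even, the colours still follow the parity of the
        index.\<close>
      define q where "q = rot k m pt"
      have qn: "q n = pt n" and q0: "q 0 = pt m" using \<open>m < n\<close> n by (auto simp: q_def rot_def)
      have q: "q i = pt ((i + m) mod n)" if "i < n" for i
        using that n by (auto simp: q_def rot_def)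
      have surj: "\<exists>j<n. q j = pt i" if "i < n" for i
        using rot_surj[of m k i pt] that \<open>m < n\<close> by (auto simp: q_def n_def)
      have img: "q ` {..n} = pt ` {..n}"
      proof (intro equalityI subsetI)
        fix x assume "x \<in> q ` {..n}"
        then obtain i where i: "i \<le> n" "x = q i" by auto
        show "x \<in> pt ` {..n}"
        proof (cases "i = n")
          case False
          then have "x = pt ((i + m) mod n)" using i q by simp
          moreover have "(i + m) mod n \<le> n" using n by (simp add: less_imp_le)
          ultimately show ?thesis by simp
        qed (use i qn n in simp)
      next
        fix x assume "x \<in> pt ` {..n}"
        then obtain i where i: "i \<le> n" "x = pt i" by auto
        show "x \<in> q ` {..n}"
        proof (cases "i = n")
          case False
          then obtain j where "j < n" "q j = x" using surj[of i] i by auto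
          then show ?thesis by force
        qed (use i qn n in force)
      qed
      have qinj: "inj_on q {..n}"
        by (rule eq_card_imp_inj_on) (use img card_image[OF inj] in auto)
      obtain j where j: "j < n" "q j = pt p" using surj[OF \<open>p < n\<close>] by blast
      have img': "q ` ({..n} - {j}) = pt ` ({..n} - {p})"
        using inj_on_image_set_diff[OF qinj, of "{..n}" "{j}"] inj_on_image_set_diff[OF inj, of "{..n}" "{p}"]
          j img \<open>p < n\<close> by simp
      interpret star_cover q "{i. q i \<in> R}" "{..n} - {j}" "(`) (inv_into ({..n} - {j}) q) ` P"
        "\<lambda>Z. inv_into ({..n} - {j}) q (c (q ` Z))"
        using reindex[OF qinj img'] .
      have inv: "inv_into ({..n} - {j}) q (q i) = i" if "i \<le> n" "i \<noteq> j" for i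
        by (rule inv_into_f_f) (use qinj that in \<open>auto intro: inj_on_subset\<close>)
      have "pt p \<noteq> pt m" using inj_onD[OF inj, of p m] m \<open>p < n\<close> by auto
      then have "j \<noteq> 0" using j(2) q0 by metis
      have qcfg: "apex_config k q" using cfg by (simp add: q_def apex_config_rot)
      show False
      proof (rule no_cover_with_apex_leaf[OF chain[OF qcfg] n(1) k refl j(1)])
        show "inv_into ({..n} - {j}) q ` Y \<in> (`) (inv_into ({..n} - {j}) q) ` P" using Y by simp
        show "inv_into ({..n} - {j}) q (c (q ` inv_into ({..n} - {j}) q ` Y)) = 0"
          unfolding im[OF Ysub[folded img']] m(3) q0[symmetric] using \<open>j \<noteq> 0\<close> by (intro inv) auto
        show "n \<in> inv_into ({..n} - {j}) q ` Y"
          using inv[of n] j(1) Y(2) qn n(2) by (metis image_eqI less_irrefl order_refl)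
        show "i \<in> {i. q i \<in> R} \<longleftrightarrow> odd i \<or> i = n" if "i \<le> n" for i
        proof (cases "i = n")
          case False
          then have "q i = pt ((i + m) mod n)" "(i + m) mod n < n" using that q n by auto
          moreover have "odd ((i + m) mod n) \<longleftrightarrow> odd i"
            using \<open>even m\<close> \<open>even n\<close> by (simp add: dvd_mod_iff)
          ultimately show ?thesis using mem[of "(i + m) mod n"] False by auto
        qed (use qn mem n in auto)
        show "closed_segment (q l) (q u) \<inter> closed_segment (q 0) (q n) \<noteq> {}"
          if "0 < l" "l < u" "u < n" "2 * k < u - l" for l u
        proof -
          have "closed_segment (q n) (q 0) \<inter> closed_segment (q l) (q u) \<noteq> {}"
            using qcfg that unfolding apex_config_def n_def by auto
          then show ?thesis by (simp add: closed_segment_commute inf_commute)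
        qed
      qed
    qed
  qed
qed

text \<open>Covered sets have size divisible by 4 and there are \<open>4 * k + 1\<close> points;
  once \<open>4 * k\<close> is excluded, at most \<open>4 * k - 4\<close> points are
  covered.\<close>

lemma max_uncovered_ge_5:
  fixes k :: nat
  assumes k: "k \<ge> 3"
  shows "max_uncovered (2 * k + 1) (2 * k) \<ge> 5"
proof -
  define n where "n = 4 * k"
  define pt where "pt = apex_pt k"
  define IR IB where "IR = {i. i \<le> n \<and> (odd i \<or> i = n)}" and "IB = {i. i < n \<and> even i}"
  define R B where "R = pt ` IR" and "B = pt ` IB"
  have inj: "inj_on pt {..n}" using inj_apex_pt by (simp add: pt_def n_def)
  have IB: "IB = (\<lambda>i. 2 * i) ` {..<2 * k}" by (auto simp: IB_def n_def image_iff elim!: evenE)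
  have cIB: "card IB = 2 * k" unfolding IB by (subst card_image) (auto simp: inj_on_def)
  have IR: "IR = {..n} - IB" by (auto simp: IR_def IB_def n_def)
  have "IB \<subseteq> {..n}" by (auto simp: IB_def)
  then have cIR: "card IR = 2 * k + 1" unfolding IR using cIB by (simp add: card_Diff_subset finite_subset n_def)
  have union: "R \<union> B = pt ` {..n}" using \<open>IB \<subseteq> {..n}\<close> by (auto simp: R_def B_def IR)
  have rb: "rb_set (2 * k + 1) (2 * k) R B" unfolding rb_set_def union
  proof (intro conjI)
    show "R \<inter> B = {}" unfolding R_def B_def
      by (subst inj_on_image_Int[OF inj, symmetric]) (auto simp: IR_def IB_def)
    show "card R = 2 * k + 1" "card B = 2 * k"
      unfolding R_def B_def using cIR cIB \<open>IB \<subseteq> {..n}\<close>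
      by (subst card_image; auto simp: IR intro: inj_on_subset[OF inj])+
    show "general_position (pt ` {..n})" using general_position_apex_pt by (simp add: pt_def n_def)
  qed (auto simp: R_def B_def IR_def IB_def)
  then have fin: "finite R" "finite B" by (auto simp: rb_set_def)
  have card: "card (R \<union> B) = n + 1" unfolding union using card_image[OF inj] by simp
  obtain X where X: "X \<subseteq> R \<union> B" "K13_coverable R B X" "card X = covered R B"
    using covered_attained[OF fin] by blast
  have "card X \<noteq> n"
  proof
    assume "card X = n"
    then have "card ((R \<union> B) - X) = 1" using X(1) fin card
      by (simp add: card_Diff_subset finite_subset)
    then obtain x where x: "(R \<union> B) - X = {x}" by (auto simp: card_1_singleton_iff)
    then have "x \<in> pt ` {..n}" using union by blast
    then obtain p where p: "p \<le> n" "x = pt p" by auto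
    have "X = (R \<union> B) - {x}" using x X(1) by blast
    also have "\<dots> = pt ` ({..n} - {p})"
      using inj_on_image_set_diff[OF inj, of "{..n}" "{p}"] p union by simp
    finally obtain P c where "K13_cover R B (pt ` ({..n} - {p})) P c"
      using X(2) K13_coverable_iff by auto
    then show False using no_apex_cover[OF k, of p P c] p
      by (simp add: R_def B_def IR_def IB_def pt_def n_def)
  qed
  moreover obtain x where "card X = 4 * x" using K13_coverable_dvd[OF X(2)] by (auto elim: dvdE)
  moreover have "card X \<le> n + 1" using card_mono[OF _ X(1)] fin card by simp
  ultimately have "card X + 4 \<le> n" by (simp add: n_def)
  then have "5 \<le> uncovered R B" using card X(3) by (simp add: uncovered_def)
  then show ?thesis using uncovered_le_max_uncovered[OF rb] by simp
qed

theorem theorem12: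
  fixes r b :: nat
  shows "(max_uncovered r b = 0 \<longleftrightarrow> r = 3 * b \<or> b = 3 * r) \<and>
         (\<forall>k::nat. k \<ge> 4 \<longrightarrow> max_uncovered (2 * k + 1) (2 * k) \<ge> 5)"
  using max_uncovered_eq_0_iff max_uncovered_ge_5 by simp

end
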